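(* For any bounded linear operator $T$ on a complex Hilbert space, any complex polynomial $p$ and any $\rho\in[1,+\infty)$, $$\|p(T)\|\leq \rho \sup_{z\in \nu_\rho(T)\cdot\overline{\mathbb D}} |p(z)|.$$
   Context: $\mathbb D$ is the open unit disc in $\mathbb C$. Let $\mathcal H\neq\{0\}$ be a complex Hilbert space, $T$ a bounded linear operator on $\mathcal H$, $\rho\in[1,+\infty)$ and $r=2(1-\frac1\rho)\in[0,2)$. For $h\in\mathcal H$ with $\|h\|=1$ put $\Delta_\rho(h)=r^2|\langle Th,h\rangle|^2-4(r-1)\|Th\|^2$. For $\rho\ne 2$ let $\mathrm{dom}(\xi_\rho)=\{h\in\mathcal H:\|h\|=1,\ (\Delta_\rho(h)>0\text{ or }Th=0)\}$, and let $\mathrm{dom}(\xi_2)=\{h\in\mathcal H:\|h\|=1\}$. For $h\in\mathrm{dom}(\xi_\rho)$ let $\xi_\rho(h)=\frac12\Big(r+\frac{\sqrt{\Delta_\rho(h)}}{|\langle Th,h\rangle|}\Big)$ if $\langle Th,h\rangle\ne0$ and $\xi_\rho(h)=1$ if $\langle Th,h\rangle=0$. The deformed numerical range is $W^\rho(T)=\mathrm{conv}\,\overline{\{\xi_\rho(h)\langle Th,h\rangle: h\in\mathrm{dom}(\xi_\rho)\}}$ and the deformed numerical radius is $\nu_\rho(T)=\sup_{z\in W^\rho(T)}|z|$. *)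

theory Defs
  imports "HOL-Analysis.Analysis" "HOL-Computational_Algebra.Polynomial"
begin

class complex_vector = real_vector +
  fixes scaleC :: "complex \<Rightarrow> 'a \<Rightarrow> 'a" (infixr \<open>*\<^sub>C\<close> 75)
  assumes scaleC_add_right: "c *\<^sub>C (x + y) = c *\<^sub>C x + c *\<^sub>C y"
    and scaleC_add_left: "(c + d) *\<^sub>C x = c *\<^sub>C x + d *\<^sub>C x"
    and scaleC_scaleC: "c *\<^sub>C d *\<^sub>C x = (c * d) *\<^sub>C x"
    and scaleC_one: "1 *\<^sub>C x = x"
    and scaleR_scaleC: "a *\<^sub>R x = complex_of_real a *\<^sub>C x"

(* The inner product is linear in its first argument and conjugate-linear in the second. *)
class complex_inner = complex_vector + real_normed_vector +
  fixes cinner :: "'a \<Rightarrow> 'a \<Rightarrow> complex"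
  assumes cinner_commute: "cinner x y = cnj (cinner y x)"
    and cinner_add_left: "cinner (x + y) z = cinner x z + cinner y z"
    and cinner_scaleC_left: "cinner (c *\<^sub>C x) y = c * cinner x y"
    and cinner_ge_zero: "0 \<le> Re (cinner x x)"
    and cinner_eq_zero_iff: "cinner x x = 0 \<longleftrightarrow> x = 0"
    and norm_eq_sqrt_cinner: "norm x = sqrt (Re (cinner x x))"

class complex_hilbert_space = complex_inner + banach

definition bounded_clinear :: "('a::complex_inner \<Rightarrow> 'b::complex_inner) \<Rightarrow> bool" where
  "bounded_clinear T \<longleftrightarrow> bounded_linear T \<and> (\<forall>c x. T (c *\<^sub>C x) = c *\<^sub>C T x)"

definition poly_op :: "complex poly \<Rightarrow> ('a::complex_inner \<Rightarrow> 'a) \<Rightarrow> 'a \<Rightarrow> 'a" where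
  "poly_op p T x = (\<Sum>i\<le>degree p. coeff p i *\<^sub>C (T ^^ i) x)"

definition deform_par :: "real \<Rightarrow> real" where
  "deform_par \<rho> = 2 * (1 - 1 / \<rho>)"

definition deform_discr :: "real \<Rightarrow> ('a::complex_inner \<Rightarrow> 'a) \<Rightarrow> 'a \<Rightarrow> real" where
  "deform_discr \<rho> T h =
     (deform_par \<rho>)\<^sup>2 * (cmod (cinner (T h) h))\<^sup>2 - 4 * (deform_par \<rho> - 1) * (norm (T h))\<^sup>2"

definition deform_dom :: "real \<Rightarrow> ('a::complex_inner \<Rightarrow> 'a) \<Rightarrow> 'a set" where
  "deform_dom \<rho> T =
     (if \<rho> = 2 then {h. norm h = 1}
      else {h. norm h = 1 \<and> (deform_discr \<rho> T h > 0 \<or> T h = 0)})"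

definition deform_factor :: "real \<Rightarrow> ('a::complex_inner \<Rightarrow> 'a) \<Rightarrow> 'a \<Rightarrow> real" where
  "deform_factor \<rho> T h =
     (if cinner (T h) h \<noteq> 0
      then (deform_par \<rho> + sqrt (deform_discr \<rho> T h) / cmod (cinner (T h) h)) / 2
      else 1)"

definition deformed_numerical_range :: "real \<Rightarrow> ('a::complex_inner \<Rightarrow> 'a) \<Rightarrow> complex set" where
  "deformed_numerical_range \<rho> T =
     convex hull
       closure ((\<lambda>h. complex_of_real (deform_factor \<rho> T h) * cinner (T h) h) ` deform_dom \<rho> T)"

(* For a bounded operator on a nonzero Hilbert space and rho at least 1 the range is bounded and
   nonempty, so the real-valued supremum is the genuine one. *)
definition deformed_numerical_radius :: "real \<Rightarrow> ('a::complex_inner \<Rightarrow> 'a) \<Rightarrow> real" where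
  "deformed_numerical_radius \<rho> T = (SUP z\<in>deformed_numerical_range \<rho> T. cmod z)"

end

theory Submission imports Defs begin

text \<open>
  By homogeneity and an approximation of the radius from above, consider \<open>S = T / R\<close> with
  \<open>R > \<nu>\<^sub>\<rho>(T)\<close>. The larger root of the quadratic \<open>u\<^sup>2 - r \<bar>\<langle>T h, h\<rangle>\<bar> u + (r - 1) \<parallel>T h\<parallel>\<^sup>2\<close> is
  \<open>\<xi>\<^sub>\<rho>(h) \<bar>\<langle>T h, h\<rangle>\<bar>\<close>, so the choice of \<open>R\<close> says that
  \<open>\<parallel>h\<parallel>\<^sup>2 - r Re \<langle>z S h, h\<rangle> + (r - 1) \<parallel>z S h\<parallel>\<^sup>2 \<ge> 0\<close> for all \<open>z\<close> in a disc slightly larger than the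
  unit disc. With \<open>y = (1 - z S) h\<close> this is positivity of \<open>Re (2 \<langle>(1 - z S)\<^sup>-\<^sup>1 y, y\<rangle> + (\<rho> - 2) \<parallel>y\<parallel>\<^sup>2)\<close>, the
  Sz.-Nagy--Foias criterion; the margin also forces \<open>S\<^sup>n \<rightarrow> 0\<close>. Averaging this positive kernel
  against a polynomial \<open>f\<close> with \<open>\<bar>f\<bar> \<le> 1\<close> on the disc, over the \<open>N\<close>-th roots of unity, gives
  \<open>\<parallel>f(S) + (\<rho> - 1) f(0)\<parallel> \<le> \<rho>\<close> as \<open>N \<rightarrow> \<infinity>\<close>. To remove the constant term, take \<open>f\<close> and a unit vector
  \<open>x\<close> almost maximizing \<open>\<parallel>f(S) x\<parallel>\<close>: variations of \<open>f\<close> show that \<open>f(S) x\<close> is then almost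
  orthogonal to \<open>x\<close>, whence \<open>\<parallel>f(S) x\<parallel> \<le> \<parallel>f(S) x + (\<rho> - 1) f(0) x\<parallel> + o(1) \<le> \<rho> + o(1)\<close>.
\<close>


subsection \<open>Complex inner product spaces\<close>

lemma cinner_scaleC_right: "cinner x (c *\<^sub>C y) = cnj c * cinner x y"
  using cinner_commute[of x "c *\<^sub>C y"] cinner_commute[of x y] by (simp add: cinner_scaleC_left)

lemma cinner_add_right: "cinner x (y + z) = cinner x y + cinner x z"
  using cinner_commute[of x "y + z"] cinner_commute[of x y] cinner_commute[of x z]
  by (simp add: cinner_add_left)

lemma Im_cinner_self [simp]: "Im (cinner x x) = 0"
  using arg_cong[OF cinner_commute[of x x], of Im] by simp

lemma Re_cinner_self: "Re (cinner x x) = (norm x)\<^sup>2"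
  by (simp add: norm_eq_sqrt_cinner cinner_ge_zero)

lemma cinner_self: "cinner x x = complex_of_real ((norm x)\<^sup>2)"
  by (simp add: complex_eq_iff Re_cinner_self del: of_real_power)

lemma norm_scaleC [simp]: "norm (c *\<^sub>C (x::'a::complex_inner)) = cmod c * norm x"
proof -
  have "cinner (c *\<^sub>C x) (c *\<^sub>C x) = (c * cnj c) * cinner x x"
    by (simp add: cinner_scaleC_left cinner_scaleC_right)
  also have "\<dots> = complex_of_real ((cmod c * norm x)\<^sup>2)"
    unfolding cinner_self power_mult_distrib of_real_mult
    by (simp add: complex_norm_square[symmetric])
  finally have "(norm (c *\<^sub>C x))\<^sup>2 = (cmod c * norm x)\<^sup>2"
    by (metis Re_cinner_self Re_complex_of_real)
  thus ?thesis by simp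
qed

section \<open>Positive semidefinite Hermitian forms, possibly degenerate\<close>

definition psd_form :: "('a::complex_inner \<Rightarrow> 'a \<Rightarrow> complex) \<Rightarrow> bool" where
  "psd_form B \<longleftrightarrow> (\<forall>x y z. B (x + y) z = B x z + B y z) \<and> (\<forall>c x y. B (c *\<^sub>C x) y = c * B x y)
     \<and> (\<forall>x y. B x y = cnj (B y x)) \<and> (\<forall>x. 0 \<le> Re (B x x))"

lemma psd_form_scaleC_right:
  assumes "psd_form B" shows "B x (c *\<^sub>C y) = cnj c * B x y"
proof -
  have "B x (c *\<^sub>C y) = cnj (B (c *\<^sub>C y) x)" "B (c *\<^sub>C y) x = c * B y x" "B x y = cnj (B y x)"
    using assms unfolding psd_form_def by blast+
  thus ?thesis by simp
qed

text \<open>Positivity at \<open>x + t *\<^sub>C y\<close>, with \<open>t\<close> rotating the cross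
  term to \<open>- cmod (B x y)\<close>. This additive form of Cauchy-Schwarz can be summed over
  many forms and passed to limits without square roots.\<close>

lemma psd_form_amgm:
  assumes "psd_form B"
  shows "2 * cmod (B x y) \<le> Re (B x x) + Re (B y y)"
proof -
  have add: "\<And>x y z. B (x + y) z = B x z + B y z" and sc: "\<And>c x y. B (c *\<^sub>C x) y = c * B x y"
    and co: "\<And>x y. B x y = cnj (B y x)" and pos: "\<And>x. 0 \<le> Re (B x x)"
    using assms unfolding psd_form_def by blast+
  have addr: "B x (y + z) = B x y + B x z" for x y z
    by (metis add co complex_cnj_add)
  define t where "t = - sgn (B x y)"
  have ts: "t * cnj t = 1" if "B x y \<noteq> 0"
    using that by (simp add: t_def complex_norm_square[symmetric] norm_sgn)
  have t: "cnj t * B x y = - complex_of_real (cmod (B x y))"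
  proof (cases "B x y = 0")
    case False
    have "B x y = - t * complex_of_real (cmod (B x y))"
      using False by (simp add: t_def sgn_eq)
    hence "cnj t * B x y = - (t * cnj t) * complex_of_real (cmod (B x y))"
      by (metis mult.assoc mult.commute minus_mult_commute)
    thus ?thesis using ts False by simp
  qed simp
  have t2: "t * cnj t * B y y = B y y \<or> B x y = 0"
    using ts by auto
  have "B (x + t *\<^sub>C y) (x + t *\<^sub>C y) = B x x + cnj t * B x y + cnj (cnj t * B x y) + t * cnj t * B y y"
    using co[of y x] by (simp add: add addr sc psd_form_scaleC_right[OF assms] algebra_simps)
  hence "Re (B (x + t *\<^sub>C y) (x + t *\<^sub>C y)) = Re (B x x) - 2 * cmod (B x y) + Re (t * cnj t * B y y)"
    unfolding t by simp
  with pos[of "x + t *\<^sub>C y"] have "0 \<le> Re (B x x) - 2 * cmod (B x y) + Re (t * cnj t * B y y)" by simp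
  with t2 pos[of x] pos[of y] show ?thesis by (elim disjE) simp_all
qed

lemma psd_form_cinner: "psd_form (cinner :: 'a::complex_inner \<Rightarrow> _)"
  unfolding psd_form_def
  by (intro conjI allI cinner_add_left cinner_scaleC_left cinner_commute cinner_ge_zero)

lemma cmod_cinner_le: "cmod (cinner x y) \<le> norm x * norm y"
proof (cases "x = 0 \<or> y = 0")
  case True
  have "cinner 0 z = 0" "cinner z 0 = 0" for z :: 'a
    using cinner_add_left[of 0 0 z] cinner_add_right[of z 0 0] by auto
  with True show ?thesis by auto
next
  case False
  define a b where "a = complex_of_real (1 / norm x)" and "b = complex_of_real (1 / norm y)"
  have "2 * cmod (cinner (a *\<^sub>C x) (b *\<^sub>C y)) \<le> (norm (a *\<^sub>C x))\<^sup>2 + (norm (b *\<^sub>C y))\<^sup>2"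
    using psd_form_amgm[OF psd_form_cinner, of "a *\<^sub>C x" "b *\<^sub>C y"] by (simp add: Re_cinner_self)
  also have "\<dots> = 2" using False by (simp add: a_def b_def norm_divide)
  finally have "cmod (cinner x y) / (norm x * norm y) \<le> 1"
    by (simp add: cinner_scaleC_left cinner_scaleC_right a_def b_def norm_mult norm_divide mult.commute)
  thus ?thesis using False by (simp add: field_simps)
qed

interpretation cinner: bounded_bilinear "cinner :: 'a::complex_inner \<Rightarrow> _"
proof
  show "\<exists>K. \<forall>a b. cmod (cinner a b) \<le> norm a * norm b * K"
    by (rule exI[of _ 1]) (simp add: cmod_cinner_le)
qed (simp_all add: cinner_add_left cinner_add_right scaleR_scaleC cinner_scaleC_left
      cinner_scaleC_right scaleR_conv_of_real)

interpretation scaleC: bounded_bilinear "scaleC :: complex \<Rightarrow> 'a::complex_inner \<Rightarrow> 'a"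
proof
  show "\<exists>K. \<forall>a (b::'a). norm (a *\<^sub>C b) \<le> norm a * norm b * K"
    by (rule exI[of _ 1]) simp
qed (simp_all add: scaleC_add_left scaleC_add_right scaleR_scaleC scaleC_scaleC
      scaleR_conv_of_real mult.commute)

lemmas cinner_simps = cinner.add_left cinner.add_right cinner.diff_left cinner.diff_right
  cinner_scaleC_left cinner_scaleC_right

lemma norm_add_sq: "(norm (x + y))\<^sup>2 = (norm x)\<^sup>2 + 2 * Re (cinner x y) + (norm (y::'a::complex_inner))\<^sup>2"
  unfolding Re_cinner_self[symmetric]
  using arg_cong[OF cinner_commute[of x y], of Re] by (simp add: cinner_simps)

lemma norm_diff_sq: "(norm (x - y))\<^sup>2 = (norm x)\<^sup>2 - 2 * Re (cinner x y) + (norm (y::'a::complex_inner))\<^sup>2"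
  unfolding Re_cinner_self[symmetric]
  using arg_cong[OF cinner_commute[of x y], of Re] by (simp add: cinner_simps)

subsection \<open>Polynomials in an operator\<close>

lemma poly_op_eq:
  assumes "degree p \<le> n"
  shows "poly_op p T x = (\<Sum>i\<le>n. coeff p i *\<^sub>C (T ^^ i) x)"
  unfolding poly_op_def using assms
  by (intro sum.mono_neutral_left) (auto simp: coeff_eq_0 scaleC.zero_left)

lemma poly_op_add: "poly_op (p + q) T x = poly_op p T x + poly_op q T x"
proof -
  let ?n = "max (degree p) (degree q)"
  have "degree (p + q) \<le> ?n" by (rule degree_add_le_max)
  thus ?thesis
    by (simp add: poly_op_eq[of _ ?n] scaleC_add_left sum.distrib)
qed

lemma poly_op_smult: "poly_op (smult c p) T x = c *\<^sub>C poly_op p T x"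
  by (subst poly_op_eq[of _ "degree p"])
    (simp_all add: poly_op_def scaleC.sum_right scaleC_scaleC)

lemma poly_op_0: "poly_op 0 T x = 0"
  by (simp add: poly_op_def scaleC.zero_left)

context
  fixes T :: "'a::complex_inner \<Rightarrow> 'a"
  assumes T: "bounded_clinear T"
begin

lemma clinear_scaleC: "T (c *\<^sub>C x) = c *\<^sub>C T x"
  using T unfolding bounded_clinear_def by blast

lemma clinear_bounded_linear: "bounded_linear T"
  using T unfolding bounded_clinear_def by blast

lemmas clinear_add = bounded_linear.linear[OF clinear_bounded_linear, THEN linear_add]
  and clinear_0 = bounded_linear.linear[OF clinear_bounded_linear, THEN linear_0]
  and clinear_sum = bounded_linear.linear[OF clinear_bounded_linear, THEN linear_sum]

lemma bounded_clinear_funpow: "bounded_clinear (T ^^ n)"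
proof (induction n)
  case 0
  show ?case by (simp add: bounded_clinear_def bounded_linear_ident id_def)
next
  case (Suc n)
  show ?case unfolding bounded_clinear_def
  proof (intro conjI allI)
    show "bounded_linear (T ^^ Suc n)"
      using bounded_linear_compose[of T "T ^^ n"] Suc clinear_bounded_linear
      unfolding bounded_clinear_def by (simp add: o_def)
    show "(T ^^ Suc n) (c *\<^sub>C x) = c *\<^sub>C (T ^^ Suc n) x" for c x
      using Suc unfolding bounded_clinear_def by (simp add: clinear_scaleC)
  qed
qed

lemma poly_op_pCons: "poly_op (pCons a p) T x = a *\<^sub>C x + T (poly_op p T x)"
proof -
  have "poly_op (pCons a p) T x = (\<Sum>i\<le>Suc (degree p). coeff (pCons a p) i *\<^sub>C (T ^^ i) x)"
    by (intro poly_op_eq) (simp add: degree_pCons_le)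
  thus ?thesis
    by (simp add: sum.atMost_Suc_shift poly_op_def clinear_sum clinear_scaleC del: sum.atMost_Suc)
qed

lemma poly_op_mult: "poly_op (p * q) T x = poly_op p T (poly_op q T x)"
  by (induction p) (simp_all add: poly_op_0 poly_op_pCons poly_op_add poly_op_smult scaleC.zero_left)

lemma bounded_clinear_poly_op: "bounded_clinear (poly_op p T)"
  unfolding bounded_clinear_def
proof (intro conjI allI)
  have "bounded_linear (\<lambda>x. coeff p i *\<^sub>C (T ^^ i) x)" for i
    using bounded_clinear_funpow[of i] unfolding bounded_clinear_def
    by (intro bounded_linear_compose[OF scaleC.bounded_linear_right]) auto
  thus "bounded_linear (poly_op p T)"
    unfolding poly_op_def[abs_def] by (intro bounded_linear_sum)
  show "poly_op p T (c *\<^sub>C x) = c *\<^sub>C poly_op p T x" for c x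
    using bounded_clinear_funpow unfolding bounded_clinear_def poly_op_def
    by (simp add: scaleC.sum_right scaleC_scaleC mult.commute)
qed

end


subsection \<open>Averaging over roots of unity\<close>

definition rou :: "nat \<Rightarrow> complex" where
  "rou N = cis (2 * pi / real N)"

lemma norm_rou [simp]: "cmod (rou N) = 1"
  by (simp add: rou_def)

lemma rou_power_N: "0 < N \<Longrightarrow> rou N ^ N = 1"
  by (simp add: rou_def Complex.DeMoivre)

lemma rou_power_inj:
  assumes "k < N" "l < N" "rou N ^ k = rou N ^ l"
  shows "k = l"
proof -
  have "inj_on (\<lambda>k. cis (2 * pi * real k / real N)) {..<N}"
    using Complex.bij_betw_roots_unity[of N] assms(1) by (auto simp: bij_betw_def)
  moreover have "rou N ^ m = cis (2 * pi * real m / real N)" for m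
    by (simp add: rou_def Complex.DeMoivre mult.commute)
  ultimately show ?thesis using assms by (auto simp: inj_on_def)
qed

text \<open>The summand is the j-th power of an N-th root of unity \<open>q\<close> that equals 1
  only for k = l, so the sum is geometric.\<close>

lemma rou_orthogonal:
  assumes "k < N" "l < N"
  shows "(\<Sum>j<N. (rou N ^ j) ^ k * cnj ((rou N ^ j) ^ l)) = (if k = l then of_nat N else 0)"
proof -
  define q where "q = rou N ^ k * cnj (rou N ^ l)"
  have cc: "rou N ^ l * cnj (rou N ^ l) = 1"
    by (simp add: complex_norm_square[symmetric] norm_power del: complex_cnj_power)
  have "(rou N ^ j) ^ k * cnj ((rou N ^ j) ^ l) = q ^ j" for j
    by (simp add: q_def power_mult_distrib power_mult[symmetric] mult.commute)
  hence sum: "(\<Sum>j<N. (rou N ^ j) ^ k * cnj ((rou N ^ j) ^ l)) = (\<Sum>j<N. q ^ j)"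
    by simp
  show ?thesis
  proof (cases "k = l")
    case True
    hence "q = 1" using cc by (simp add: q_def)
    thus ?thesis using True unfolding sum by simp
  next
    case False
    have "q \<noteq> 1"
    proof
      assume "q = 1"
      hence "rou N ^ k * (rou N ^ l * cnj (rou N ^ l)) = rou N ^ l"
        by (simp add: q_def)
      thus False using rou_power_inj[OF assms] False unfolding cc by simp
    qed
    moreover have "q ^ N = (rou N ^ N) ^ k * cnj ((rou N ^ N) ^ l)"
      by (simp add: q_def power_mult_distrib power_mult[symmetric] mult.commute)
    hence "q ^ N = 1" using assms by (simp add: rou_power_N)
    ultimately show ?thesis using False unfolding sum by (simp add: geometric_sum)
  qed
qed

section \<open>Truncated Neumann series of the inverse of 1 - z T, and their averages\<close>

definition geo_op :: "('a::complex_inner \<Rightarrow> 'a) \<Rightarrow> nat \<Rightarrow> complex \<Rightarrow> 'a \<Rightarrow> 'a" where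
  "geo_op T N z x = (\<Sum>k<N. z ^ k *\<^sub>C (T ^^ k) x)"

text \<open>At z with z^N = 1 the right side no longer depends on z; this is why N-th roots of unity
  are used as nodes.\<close>

lemma geo_op_telescope:
  assumes "bounded_clinear T"
  shows "geo_op T N z x - z *\<^sub>C T (geo_op T N z x) = x - z ^ N *\<^sub>C (T ^^ N) x"
proof (induction N)
  case 0
  show ?case by (simp add: geo_op_def clinear_0[OF assms] scaleC.zero_right scaleC_one)
next
  case (Suc N)
  define u where "u = z ^ N *\<^sub>C (T ^^ N) x"
  have g: "geo_op T (Suc N) z x = geo_op T N z x + u"
    by (simp add: geo_op_def u_def)
  have "z *\<^sub>C T u = z ^ Suc N *\<^sub>C (T ^^ Suc N) x"
    by (simp add: u_def clinear_scaleC[OF assms] scaleC_scaleC)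
  moreover have "geo_op T N z x - z *\<^sub>C T (geo_op T N z x) = x - u"
    using Suc by (simp add: u_def)
  ultimately show ?case
    unfolding g clinear_add[OF assms] scaleC_add_right by (simp add: algebra_simps)
qed

text \<open>Discrete Fourier inversion: the average isolates the l-th coefficient of the truncated
  series, and \<open>l < N\<close> excludes aliasing.\<close>

lemma rou_average:
  assumes "l < N"
  shows "(\<Sum>j<N. cnj ((rou N ^ j) ^ l) *\<^sub>C geo_op T N (s * rou N ^ j) x) =
    (of_nat N * s ^ l) *\<^sub>C (T ^^ l) x"
proof -
  have "(\<Sum>j<N. cnj ((rou N ^ j) ^ l) *\<^sub>C geo_op T N (s * rou N ^ j) x) =
      (\<Sum>j<N. \<Sum>k<N. (s ^ k * ((rou N ^ j) ^ k * cnj ((rou N ^ j) ^ l))) *\<^sub>C (T ^^ k) x)"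
    unfolding geo_op_def scaleC.sum_right scaleC_scaleC power_mult_distrib
    by (simp only: mult_ac)
  also have "\<dots> = (\<Sum>k<N. (s ^ k * (\<Sum>j<N. (rou N ^ j) ^ k * cnj ((rou N ^ j) ^ l))) *\<^sub>C (T ^^ k) x)"
    by (subst sum.swap) (simp only: scaleC.sum_left sum_distrib_left)
  also have "\<dots> = (\<Sum>k<N. if k = l then (of_nat N * s ^ l) *\<^sub>C (T ^^ l) x else 0)"
    using assms by (intro sum.cong)
      (simp_all add: rou_orthogonal scaleC.zero_left mult.commute del: complex_cnj_power)
  finally show ?thesis using assms by simp
qed

text \<open>Parseval's identity for the coefficients \<open>s ^ k *\<^sub>R (T ^^ k) x\<close>. Only
  the second factor of each inner product is expanded; \<open>rou_average\<close> then evaluates the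
  first.\<close>

lemma geo_op_parseval:
  "(\<Sum>j<N. (norm (geo_op T N (complex_of_real s * rou N ^ j) x))\<^sup>2) =
    real N * (\<Sum>k<N. (s ^ k * norm ((T ^^ k) x))\<^sup>2)"
proof -
  define g where "g j = geo_op T N (complex_of_real s * rou N ^ j) x" for j
  have "cinner (g j) (g j) =
      (\<Sum>k<N. of_real s ^ k * cinner (cnj ((rou N ^ j) ^ k) *\<^sub>C g j) ((T ^^ k) x))" for j
    by (subst (2) g_def)
      (simp add: geo_op_def cinner.sum_right cinner_scaleC_right cinner_scaleC_left
        power_mult_distrib mult_ac)
  hence "(\<Sum>j<N. cinner (g j) (g j)) =
      (\<Sum>j<N. \<Sum>k<N. of_real s ^ k * cinner (cnj ((rou N ^ j) ^ k) *\<^sub>C g j) ((T ^^ k) x))"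
    by simp
  also have "\<dots> =
      (\<Sum>k<N. of_real s ^ k * cinner (\<Sum>j<N. cnj ((rou N ^ j) ^ k) *\<^sub>C g j) ((T ^^ k) x))"
    by (subst sum.swap) (simp only: cinner.sum_left sum_distrib_left)
  also have "\<dots> = (\<Sum>k<N. of_real s ^ k * cinner ((of_nat N * of_real s ^ k) *\<^sub>C (T ^^ k) x) ((T ^^ k) x))"
    unfolding g_def by (intro sum.cong refl) (simp only: rou_average lessThan_iff)
  also have "\<dots> = complex_of_real (real N * (\<Sum>k<N. (s ^ k * norm ((T ^^ k) x))\<^sup>2))"
    by (simp add: cinner_scaleC_left cinner_self sum_distrib_left power_mult_distrib
        power2_eq_square mult_ac)
  finally have "Re (\<Sum>j<N. cinner (g j) (g j)) = real N * (\<Sum>k<N. (s ^ k * norm ((T ^^ k) x))\<^sup>2)"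
    by (metis Re_complex_of_real)
  thus ?thesis by (simp add: Re_cinner_self g_def)
qed


subsection \<open>Uniform resolvent bounds\<close>

lemma funpow_add_apply: "(f ^^ (m + n)) x = (f ^^ m) ((f ^^ n) x)"
  by (simp add: funpow_add)

definition powers_vanish :: "('a::complex_inner \<Rightarrow> 'a) \<Rightarrow> real \<Rightarrow> bool" where
  "powers_vanish T s \<longleftrightarrow> (\<forall>x. (\<lambda>n. s ^ n * norm ((T ^^ n) x)) \<longlonglongrightarrow> 0)"

lemma powers_vanish_mono:
  assumes "powers_vanish T t" "0 \<le> s" "s \<le> t"
  shows "powers_vanish T s"
  unfolding powers_vanish_def
proof
  fix x
  have "(\<lambda>n. t ^ n * norm ((T ^^ n) x)) \<longlonglongrightarrow> 0"
    using assms(1) by (simp add: powers_vanish_def)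
  thus "(\<lambda>n. s ^ n * norm ((T ^^ n) x)) \<longlonglongrightarrow> 0"
    by (rule Lim_null_comparison[rotated])
      (use assms in \<open>auto intro!: always_eventually mult_right_mono power_mono\<close>)
qed

text \<open>A bound C for the inverse of 1 - z T on a disc, phrased as a lower bound so that no
  inverse has to be exhibited.\<close>

definition resolvent_bound :: "('a::complex_inner \<Rightarrow> 'a) \<Rightarrow> real \<Rightarrow> real \<Rightarrow> bool" where
  "resolvent_bound T C s \<longleftrightarrow> (\<forall>z h. cmod z \<le> s \<longrightarrow> norm h \<le> C * norm (h - z *\<^sub>C T h))"

context
  fixes T :: "'a::complex_inner \<Rightarrow> 'a" and C :: real
  assumes T: "bounded_clinear T" and C: "0 \<le> C"
begin

text \<open>The resolvent bound is applied to truncated Neumann series, whose images under 1 - z T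
  are \<open>x - z ^ N *\<^sub>C (T ^^ N) x\<close>. Parseval turns the average over the circle of
  radius s into the sum of squares, and the remainder disappears as N grows.\<close>

lemma sum_powers_le:
  assumes R: "resolvent_bound T C s" and s: "0 \<le> s" and v: "powers_vanish T s"
  shows "(\<Sum>k<M. (s ^ k * norm ((T ^^ k) x))\<^sup>2) \<le> C\<^sup>2 * (norm x)\<^sup>2"
proof -
  have *: "(\<Sum>k<M. (s ^ k * norm ((T ^^ k) x))\<^sup>2) \<le> C\<^sup>2 * (norm x + s ^ N * norm ((T ^^ N) x))\<^sup>2"
    if N: "M \<le> N" "0 < N" for N
  proof -
    have g: "(norm (geo_op T N (of_real s * rou N ^ j) x))\<^sup>2 \<le> C\<^sup>2 * (norm x + s ^ N * norm ((T ^^ N) x))\<^sup>2" for j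
    proof -
      let ?z = "of_real s * rou N ^ j"
      have "norm (geo_op T N ?z x) \<le> C * norm (geo_op T N ?z x - ?z *\<^sub>C T (geo_op T N ?z x))"
        using R s unfolding resolvent_bound_def by (simp add: norm_mult norm_power)
      also have "\<dots> = C * norm (x - ?z ^ N *\<^sub>C (T ^^ N) x)"
        by (simp only: geo_op_telescope[OF T])
      also have "\<dots> \<le> C * (norm x + s ^ N * norm ((T ^^ N) x))"
        using C norm_triangle_ineq4[of x "?z ^ N *\<^sub>C (T ^^ N) x"] s
        by (intro mult_left_mono) (simp_all add: norm_mult norm_power)
      finally show ?thesis
        by (metis norm_ge_zero power_mono power_mult_distrib)
    qed
    have "real N * (\<Sum>k<N. (s ^ k * norm ((T ^^ k) x))\<^sup>2) \<le>
        real N * (C\<^sup>2 * (norm x + s ^ N * norm ((T ^^ N) x))\<^sup>2)"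
      unfolding geo_op_parseval[symmetric] using sum_bounded_above[of "{..<N}", OF g] by simp
    hence "(\<Sum>k<N. (s ^ k * norm ((T ^^ k) x))\<^sup>2) \<le> C\<^sup>2 * (norm x + s ^ N * norm ((T ^^ N) x))\<^sup>2"
      using N by simp
    moreover have "(\<Sum>k<M. (s ^ k * norm ((T ^^ k) x))\<^sup>2) \<le> (\<Sum>k<N. (s ^ k * norm ((T ^^ k) x))\<^sup>2)"
      using N by (intro sum_mono2) auto
    ultimately show ?thesis by linarith
  qed
  have "(\<lambda>N. C\<^sup>2 * (norm x + s ^ N * norm ((T ^^ N) x))\<^sup>2) \<longlonglongrightarrow> C\<^sup>2 * (norm x + 0)\<^sup>2"
    using v unfolding powers_vanish_def by (intro tendsto_intros) auto
  hence "(\<Sum>k<M. (s ^ k * norm ((T ^^ k) x))\<^sup>2) \<le> C\<^sup>2 * (norm x + 0)\<^sup>2"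
    by (rule LIMSEQ_le_const) (use * in \<open>auto intro!: exI[of _ "max M 1"]\<close>)
  thus ?thesis by simp
qed

lemma norm_funpow_le:
  assumes "resolvent_bound T C s" "0 \<le> s" "powers_vanish T s"
  shows "s ^ k * norm ((T ^^ k) x) \<le> C * norm x"
proof -
  have "(s ^ k * norm ((T ^^ k) x))\<^sup>2 \<le> (\<Sum>k<Suc k. (s ^ k * norm ((T ^^ k) x))\<^sup>2)"
    by (rule member_le_sum) auto
  also have "\<dots> \<le> C\<^sup>2 * (norm x)\<^sup>2" by (rule sum_powers_le[OF assms])
  finally have "(s ^ k * norm ((T ^^ k) x))\<^sup>2 \<le> (C * norm x)\<^sup>2" by (simp add: power_mult_distrib)
  thus ?thesis by (rule power2_le_imp_le) (use C in simp)
qed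

text \<open>Square summability of the orbits forces decay of the powers at a rate depending on
  \<open>C\<close> only, so the radius \<open>s\<close> can be enlarged by a fixed factor.\<close>
lemma powers_vanish_step:
  assumes R: "resolvent_bound T C s" and s: "0 \<le> s" and v: "powers_vanish T s"
    and n: "4 * C ^ 4 \<le> real n" "0 < n" and q: "1 \<le> q" "q ^ n \<le> 3 / 2"
  shows "powers_vanish T (s * q)"
proof -
  \<comment> \<open>Every earlier term \<open>?A k\<close> dominates \<open>?A n\<close> up to the
    factor C, so n copies of \<open>(?A n)\<^sup>2\<close> fit below
    \<open>C ^ 4 * (norm x)\<^sup>2\<close>; the size of n then yields 1/2.\<close>
  have half: "s ^ n * norm ((T ^^ n) x) \<le> norm x / 2" for x
  proof -
    let ?A = "\<lambda>k. s ^ k * norm ((T ^^ k) x)"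
    have "(?A n)\<^sup>2 \<le> C\<^sup>2 * (?A k)\<^sup>2" if "k < n" for k
    proof -
      have "?A n = s ^ k * (s ^ (n - k) * norm ((T ^^ (n - k)) ((T ^^ k) x)))"
        using that funpow_add_apply[of "n - k" k T x]
        by (simp add: power_add[symmetric] mult.assoc[symmetric])
      also have "\<dots> \<le> s ^ k * (C * norm ((T ^^ k) x))"
        using s by (intro mult_left_mono norm_funpow_le[OF R s v]) auto
      finally have "?A n \<le> C * ?A k" by (simp add: mult_ac)
      moreover have "0 \<le> ?A n" using s by simp
      ultimately show ?thesis by (metis power_mono power_mult_distrib)
    qed
    hence "real n * (?A n)\<^sup>2 \<le> (\<Sum>k<n. C\<^sup>2 * (?A k)\<^sup>2)"
      using sum_bounded_below[of "{..<n}" "(?A n)\<^sup>2"] by auto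
    also have "\<dots> \<le> C\<^sup>2 * (C\<^sup>2 * (norm x)\<^sup>2)"
      unfolding sum_distrib_left[symmetric]
      by (intro mult_left_mono sum_powers_le[OF R s v]) auto
    also have "\<dots> = C ^ 4 * (norm x)\<^sup>2" by (simp add: power2_eq_square power4_eq_xxxx)
    also have "\<dots> \<le> (real n / 4) * (norm x)\<^sup>2"
      using n by (intro mult_right_mono) auto
    finally have "(?A n)\<^sup>2 \<le> (norm x / 2)\<^sup>2" using n by (simp add: field_simps power2_eq_square)
    thus ?thesis by (rule power2_le_imp_le) simp
  qed
  \<comment> \<open>The enlarged radius costs \<open>q ^ n \<le> 3 / 2\<close> against the gain 1/2,
    leaving a ratio 3/4 < 1 for every block of n powers.\<close>
  have base: "(s * q) ^ n * norm ((T ^^ n) x) \<le> 3 / 4 * norm x" for x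
  proof -
    have "(s * q) ^ n * norm ((T ^^ n) x) = q ^ n * (s ^ n * norm ((T ^^ n) x))"
      by (simp add: power_mult_distrib)
    also have "\<dots> \<le> 3 / 2 * (norm x / 2)"
      using q s half by (intro mult_mono) auto
    finally show ?thesis by simp
  qed
  have iter: "(s * q) ^ (n * m) * norm ((T ^^ (n * m)) x) \<le> (3 / 4) ^ m * norm x" for m x
  proof (induction m)
    case (Suc m)
    have "(s * q) ^ (n * Suc m) * norm ((T ^^ (n * Suc m)) x) =
        (s * q) ^ (n * m) * ((s * q) ^ n * norm ((T ^^ n) ((T ^^ (n * m)) x)))"
      by (simp add: funpow_add_apply power_add)
    also have "\<dots> \<le> (s * q) ^ (n * m) * (3 / 4 * norm ((T ^^ (n * m)) x))"
      using s q base by (intro mult_left_mono) auto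
    finally show ?case using Suc by simp
  qed simp
  show ?thesis unfolding powers_vanish_def
  proof
    fix x
    \<comment> \<open>Whole blocks of length n decay geometrically; the incomplete block of length
      \<open>k mod n\<close> costs at most \<open>3 / 2 * C\<close>.\<close>
    have b: "(s * q) ^ k * norm ((T ^^ k) x) \<le> (3 / 4) ^ (k div n) * (3 / 2 * (C * norm x))" for k
    proof -
      define j where "j = k mod n"
      have k: "k = n * (k div n) + j" by (simp add: j_def)
      have "(s * q) ^ k * norm ((T ^^ k) x) =
          (s * q) ^ j * ((s * q) ^ (n * (k div n)) * norm ((T ^^ (n * (k div n))) ((T ^^ j) x)))"
        by (subst (1 2) k) (simp only: funpow_add_apply power_add mult_ac)
      also have "\<dots> \<le> (s * q) ^ j * ((3 / 4) ^ (k div n) * norm ((T ^^ j) x))"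
        using s q iter by (intro mult_left_mono) auto
      also have "\<dots> = (3 / 4) ^ (k div n) * (q ^ j * (s ^ j * norm ((T ^^ j) x)))"
        by (simp add: power_mult_distrib)
      also have "\<dots> \<le> (3 / 4) ^ (k div n) * (3 / 2 * (C * norm x))"
      proof (rule mult_left_mono)
        have "q ^ j \<le> q ^ n" using q n by (intro power_increasing) (auto simp: j_def less_imp_le)
        hence "q ^ j \<le> 3 / 2" using q by simp
        thus "q ^ j * (s ^ j * norm ((T ^^ j) x)) \<le> 3 / 2 * (C * norm x)"
          using s by (intro mult_mono[OF _ norm_funpow_le[OF R s v]]) auto
      qed simp
      finally show ?thesis .
    qed
    have "filterlim (\<lambda>k. k div n) at_top sequentially"
      using n by (intro filterlim_at_top_div_const_nat)
    hence "(\<lambda>k. (3 / 4 :: real) ^ (k div n)) \<longlonglongrightarrow> 0"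
      by (rule filterlim_compose[rotated]) (auto intro: LIMSEQ_power_zero)
    hence "(\<lambda>k. (3 / 4) ^ (k div n) * (3 / 2 * (C * norm x))) \<longlonglongrightarrow> 0"
      by (rule tendsto_mult_left_zero)
    thus "(\<lambda>k. (s * q) ^ k * norm ((T ^^ k) x)) \<longlonglongrightarrow> 0"
      by (rule Lim_null_comparison[rotated]) (use s q b in auto)
  qed
qed

lemma powers_vanish_small: "\<exists>s>0. powers_vanish T s"
proof -
  obtain K where K: "K > 0" "\<And>x. norm (T x) \<le> norm x * K"
    using bounded_linear.pos_bounded[OF clinear_bounded_linear[OF T]] by blast
  define s where "s = 1 / (2 * K)"
  have s: "s > 0" using K by (simp add: s_def)
  have "s ^ n * norm ((T ^^ n) x) \<le> (1 / 2) ^ n * norm x" for n x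
  proof (induction n)
    case (Suc n)
    have "s ^ Suc n * norm ((T ^^ Suc n) x) \<le> s ^ Suc n * (norm ((T ^^ n) x) * K)"
      using s K by (intro mult_left_mono) auto
    also have "\<dots> = (s ^ n * norm ((T ^^ n) x)) / 2" using K(1) by (simp add: s_def)
    finally show ?case using Suc by simp
  qed simp
  hence b: "norm (s ^ n * norm ((T ^^ n) x)) \<le> (1 / 2) ^ n * norm x" for n x
    using s by simp
  have "powers_vanish T s" unfolding powers_vanish_def
  proof
    fix x :: 'a
    have "(\<lambda>n. (1 / 2) ^ n * norm x) \<longlonglongrightarrow> 0"
      by (intro tendsto_mult_left_zero LIMSEQ_power_zero) auto
    thus "(\<lambda>n. s ^ n * norm ((T ^^ n) x)) \<longlonglongrightarrow> 0"
      by (rule Lim_null_comparison[rotated]) (intro always_eventually allI b)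
  qed
  thus ?thesis using s by blast
qed

text \<open>Continuation in the radius: decay holds at some small t, and each step multiplies the
  radius by a factor q that depends on C alone, so finitely many steps reach s. The minimum with s
  keeps every radius inside the disc where the bound is assumed.\<close>

lemma powers_vanish_if_resolvent_bound:
  assumes R: "resolvent_bound T C s" and s: "0 \<le> s"
  shows "powers_vanish T s"
proof -
  obtain t where t: "t > 0" "powers_vanish T t" using powers_vanish_small by blast
  \<comment> \<open>The summand 1 keeps n positive even when C = 0.\<close>
  obtain n where n: "4 * C ^ 4 + 1 \<le> real n" using real_arch_simple by blast
  moreover have "0 \<le> C ^ 4" using C by simp
  ultimately have n': "4 * C ^ 4 \<le> real n" "0 < n" by linarith+
  define q where "q = root n (3 / 2)"
  have q: "1 < q" "q ^ n = 3 / 2" using n' by (simp_all add: q_def)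
  have "powers_vanish T (min (t * q ^ k) s)" for k
  proof (induction k)
    case 0
    show ?case using t s by (auto intro: powers_vanish_mono[OF t(2)])
  next
    case (Suc k)
    let ?u = "min (t * q ^ k) s"
    have u: "0 \<le> ?u" using t q s by simp
    have "resolvent_bound T C ?u" using R by (auto simp: resolvent_bound_def)
    from powers_vanish_step[OF this u Suc n'(1,2), of q] q
    have "powers_vanish T (?u * q)" by simp
    thus ?case
    proof (rule powers_vanish_mono)
      show "0 \<le> min (t * q ^ Suc k) s" using t q s by simp
      have "min (t * q ^ Suc k) s \<le> min (t * q ^ Suc k) (s * q)"
        using s q mult_left_mono[of 1 q s] by (intro min.mono) auto
      also have "\<dots> = ?u * q" using q by (subst min_mult_distrib_right) (simp add: mult_ac)
      finally show "min (t * q ^ Suc k) s \<le> ?u * q" .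
    qed
  qed
  moreover obtain k where "s / t < q ^ k" using real_arch_pow[OF q(1)] by blast
  hence "min (t * q ^ k) s = s" using t by (simp add: field_simps)
  ultimately show ?thesis by metis
qed

end


subsection \<open>Operators with a positive resolvent kernel\<close>

text \<open>Half of the Sz.-Nagy--Foias expression, parametrized by h instead of y = (1 - z S)
  h.\<close>

definition resolvent_positive :: "real \<Rightarrow> ('a::complex_inner \<Rightarrow> 'a) \<Rightarrow> bool" where
  "resolvent_positive \<rho> S \<longleftrightarrow> (\<forall>z h. cmod z = 1 \<longrightarrow>
     0 \<le> Re (cinner (h + complex_of_real ((\<rho> - 2) / 2) *\<^sub>C (h - z *\<^sub>C S h)) (h - z *\<^sub>C S h)))"

context
  fixes S :: "'a::complex_inner \<Rightarrow> 'a" and \<rho> :: real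
  assumes S: "bounded_clinear S" and \<rho>: "1 \<le> \<rho>"
    and pos: "resolvent_positive \<rho> S" and van: "powers_vanish S 1"
begin

section \<open>The discrete resolvent kernel and its averages over roots of unity\<close>

definition defect :: "nat \<Rightarrow> 'a \<Rightarrow> 'a" where
  "defect N x = x - (S ^^ N) x"

definition kernel_vec :: "nat \<Rightarrow> nat \<Rightarrow> 'a \<Rightarrow> 'a" where
  "kernel_vec N j x = geo_op S N (rou N ^ j) x + complex_of_real ((\<rho> - 2) / 2) *\<^sub>C defect N x"

text \<open>The polarization of twice the real part in \<open>resolvent_positive\<close> at z =
  \<open>rou N ^ j\<close>: the truncated Neumann series takes the place of h, and
  \<open>defect N x\<close>, its image under 1 - z S, that of h - z S h.\<close>

definition kernel :: "nat \<Rightarrow> nat \<Rightarrow> 'a \<Rightarrow> 'a \<Rightarrow> complex" where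
  "kernel N j x y = cinner (kernel_vec N j x) (defect N y) + cinner (defect N x) (kernel_vec N j y)"

lemma funpow_add_arg: "(S ^^ N) (x + y) = (S ^^ N) x + (S ^^ N) y"
  using clinear_add[OF bounded_clinear_funpow[OF S]] .

lemma funpow_scaleC: "(S ^^ N) (c *\<^sub>C x) = c *\<^sub>C (S ^^ N) x"
  using clinear_scaleC[OF bounded_clinear_funpow[OF S]] .

lemma defect_add: "defect N (x + y) = defect N x + defect N y"
  by (simp add: defect_def funpow_add_arg)

lemma defect_scaleC: "defect N (c *\<^sub>C x) = c *\<^sub>C defect N x"
  by (simp add: defect_def funpow_scaleC scaleC.diff_right)

lemma kernel_vec_add: "kernel_vec N j (x + y) = kernel_vec N j x + kernel_vec N j y"
  by (simp add: kernel_vec_def geo_op_def defect_add funpow_add_arg scaleC_add_right sum.distrib)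

lemma kernel_vec_scaleC: "kernel_vec N j (c *\<^sub>C x) = c *\<^sub>C kernel_vec N j x"
  by (simp add: kernel_vec_def geo_op_def defect_scaleC funpow_scaleC scaleC_add_right
      scaleC.sum_right scaleC_scaleC mult.commute)

lemma psd_form_kernel:
  assumes "0 < N"
  shows "psd_form (kernel N j)"
  unfolding psd_form_def
proof (intro conjI allI)
  fix x y z c
  show "kernel N j (x + y) z = kernel N j x z + kernel N j y z"
    by (simp add: kernel_def kernel_vec_add defect_add cinner_simps)
  show "kernel N j (c *\<^sub>C x) y = c * kernel N j x y"
    by (simp add: kernel_def kernel_vec_scaleC defect_scaleC cinner_simps algebra_simps)
  show "kernel N j x y = cnj (kernel N j y x)"
    unfolding kernel_def complex_cnj_add
    by (subst (1 2) cinner_commute) simp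
  have z: "(rou N ^ j) ^ N = 1"
    using rou_power_N[OF assms] by (metis mult.commute power_mult power_one)
  have d: "defect N x = geo_op S N (rou N ^ j) x - rou N ^ j *\<^sub>C S (geo_op S N (rou N ^ j) x)"
    unfolding geo_op_telescope[OF S] z by (simp add: defect_def scaleC_one)
  have "0 \<le> Re (cinner (kernel_vec N j x) (defect N x))"
    using pos unfolding resolvent_positive_def kernel_vec_def d by (simp add: norm_power)
  moreover have "Re (cinner (defect N x) (kernel_vec N j x)) = Re (cinner (kernel_vec N j x) (defect N x))"
    by (subst cinner_commute) simp
  ultimately show "0 \<le> Re (kernel N j x x)" by (simp add: kernel_def)
qed

text \<open>The first half of the kernel contributes the frequency m. The second half is
  conjugate-linear in its series, so it contributes the frequency -m, which is N - m modulo N; the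
  outer \<open>mod\<close> covers m = 0.\<close>

lemma kernel_average_monomial:
  assumes m: "m < N"
  shows "(\<Sum>j<N. cnj (rou N ^ j) ^ m * kernel N j x y) = of_nat N *
     (cinner ((S ^^ m) x) (defect N y) + cinner (defect N x) ((S ^^ ((N - m) mod N)) y)
       + (if m = 0 then complex_of_real (\<rho> - 2) * cinner (defect N x) (defect N y) else 0))"
proof -
  let ?c = "complex_of_real ((\<rho> - 2) / 2)" and ?u = "\<lambda>j. cnj (rou N ^ j) ^ m"
  define l where "l = (N - m) mod N"
  have l: "l < N" using m by (simp add: l_def)
  have avg: "(\<Sum>j<N. cnj ((rou N ^ j) ^ i) *\<^sub>C geo_op S N (rou N ^ j) x) = of_nat N *\<^sub>C (S ^^ i) x"
    if "i < N" for i x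
    using rou_average[OF that, of S 1 x] by simp
  \<comment> \<open>Since m + l is 0 or N, the l-th power of a root of unity is the conjugate of its
    m-th power.\<close>
  have u_l: "cnj (?u j) = cnj ((rou N ^ j) ^ l)" for j
  proof (cases "m = 0")
    case False
    have "(rou N ^ j) ^ m * (rou N ^ j) ^ l = (rou N ^ N) ^ j"
      using False m by (simp add: l_def power_add[symmetric] power_mult[symmetric]
          add_mult_distrib2[symmetric] mult.commute)
    hence 1: "(rou N ^ j) ^ m * (rou N ^ j) ^ l = 1" using m by (simp add: rou_power_N)
    have "(rou N ^ j) ^ l * cnj ((rou N ^ j) ^ l) = 1"
      by (simp add: complex_norm_square[symmetric] norm_power del: complex_cnj_power)
    hence "(rou N ^ j) ^ m = ((rou N ^ j) ^ m * (rou N ^ j) ^ l) * cnj ((rou N ^ j) ^ l)"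
      by (simp only: mult.assoc mult_1_right)
    thus ?thesis unfolding 1 by simp
  qed (simp add: l_def)
  have u0: "(\<Sum>j<N. ?u j) = (if m = 0 then of_nat N else 0)"
    using rou_orthogonal[of 0 N m] m by auto
  have 1: "(\<Sum>j<N. ?u j * cinner (kernel_vec N j x) (defect N y)) =
      of_nat N * cinner ((S ^^ m) x) (defect N y)
      + (if m = 0 then of_nat N * (?c * cinner (defect N x) (defect N y)) else 0)"
  proof -
    have "(\<Sum>j<N. ?u j * cinner (kernel_vec N j x) (defect N y)) =
      cinner (\<Sum>j<N. cnj ((rou N ^ j) ^ m) *\<^sub>C geo_op S N (rou N ^ j) x) (defect N y)
      + (\<Sum>j<N. ?u j) * (?c * cinner (defect N x) (defect N y))"
      by (simp add: kernel_vec_def cinner_simps cinner.sum_left sum_distrib_right sum.distrib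
          distrib_left)
    thus ?thesis unfolding avg[OF m] u0 by (simp add: cinner_simps)
  qed
  have 2: "(\<Sum>j<N. ?u j * cinner (defect N x) (kernel_vec N j y)) =
      of_nat N * cinner (defect N x) ((S ^^ l) y)
      + (if m = 0 then of_nat N * (?c * cinner (defect N x) (defect N y)) else 0)"
  proof -
    have "(\<Sum>j<N. ?u j * cinner (defect N x) (kernel_vec N j y)) =
      cinner (defect N x) (\<Sum>j<N. cnj (?u j) *\<^sub>C geo_op S N (rou N ^ j) y)
      + (\<Sum>j<N. ?u j) * (?c * cinner (defect N x) (defect N y))"
      by (simp add: kernel_vec_def cinner_simps cinner.sum_right sum_distrib_right sum.distrib
          distrib_left)
    thus ?thesis unfolding u_l avg[OF l] u0 by (simp add: cinner_simps)
  qed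
  have "(\<Sum>j<N. ?u j * kernel N j x y) = (\<Sum>j<N. ?u j * cinner (kernel_vec N j x) (defect N y))
      + (\<Sum>j<N. ?u j * cinner (defect N x) (kernel_vec N j y))"
    by (simp add: kernel_def distrib_left sum.distrib)
  thus ?thesis unfolding 1 2 l_def by (simp add: field_simps)
qed

lemma funpow_vanish: "(\<lambda>N. (S ^^ N) x) \<longlonglongrightarrow> 0"
  using van by (simp add: powers_vanish_def tendsto_norm_zero_iff)

lemma defect_tendsto: "(\<lambda>N. defect N x) \<longlonglongrightarrow> x"
  using tendsto_diff[OF tendsto_const funpow_vanish, of x x] by (simp add: defect_def)

text \<open>For m > 0 the aliased term contains \<open>S ^^ (N - m)\<close> and dies out, leaving
  the term of \<open>S ^^ m\<close>. For m = 0 all three terms survive with total weight 1 + 1 +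
  (\<rho> - 2) = \<rho>, whence the extra (\<rho> - 1) f(0).\<close>

lemma kernel_average_tendsto:
  "(\<lambda>N. (\<Sum>j<N. poly f (cnj (rou N ^ j)) * kernel N j x y) / of_nat N) \<longlonglongrightarrow>
     cinner (poly_op f S x + (complex_of_real (\<rho> - 1) * poly f 0) *\<^sub>C x) y"
proof -
  define L where "L m = cinner ((S ^^ m) x) y + (if m = 0 then complex_of_real (\<rho> - 1) * cinner x y else 0)" for m
  define K where "K m N = cinner ((S ^^ m) x) (defect N y) + cinner (defect N x) ((S ^^ ((N - m) mod N)) y)
       + (if m = 0 then complex_of_real (\<rho> - 2) * cinner (defect N x) (defect N y) else 0)" for m N
  have K: "K m \<longlonglongrightarrow> L m" for m
  proof (cases "m = 0")
    case True
    have "(\<lambda>N. cinner x (defect N y) + cinner (defect N x) y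
        + complex_of_real (\<rho> - 2) * cinner (defect N x) (defect N y)) \<longlonglongrightarrow>
        cinner x y + cinner x y + complex_of_real (\<rho> - 2) * cinner x y"
      by (intro tendsto_intros cinner.tendsto defect_tendsto)
    thus ?thesis using True unfolding K_def[abs_def] L_def by (simp add: algebra_simps)
  next
    case False
    have "(\<lambda>N. (S ^^ (N - m)) y) \<longlonglongrightarrow> 0"
      using LIMSEQ_offset[of "\<lambda>N. (S ^^ (N - m)) y" m] funpow_vanish[of y] by simp
    hence "(\<lambda>N. cinner ((S ^^ m) x) (defect N y) + cinner (defect N x) ((S ^^ (N - m)) y))
        \<longlonglongrightarrow> cinner ((S ^^ m) x) y + cinner x 0"
      by (intro tendsto_intros cinner.tendsto defect_tendsto)
    moreover have "\<forall>\<^sub>F N in sequentially. cinner ((S ^^ m) x) (defect N y) +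
        cinner (defect N x) ((S ^^ (N - m)) y) = K m N"
      using eventually_gt_at_top[of 0] by eventually_elim (use False in \<open>simp add: K_def\<close>)
    ultimately show ?thesis
      using False tendsto_cong[of "\<lambda>N. cinner ((S ^^ m) x) (defect N y) +
        cinner (defect N x) ((S ^^ (N - m)) y)" "K m" sequentially]
      by (simp add: L_def cinner.zero_right)
  qed
  have "(\<lambda>N. \<Sum>m\<le>degree f. coeff f m * K m N) \<longlonglongrightarrow> (\<Sum>m\<le>degree f. coeff f m * L m)"
    by (intro tendsto_sum tendsto_mult tendsto_const K)
  also have "(\<Sum>m\<le>degree f. coeff f m * L m) =
      cinner (poly_op f S x + (complex_of_real (\<rho> - 1) * poly f 0) *\<^sub>C x) y"
  proof -
    have "(\<Sum>m\<le>degree f. coeff f m * L m) = (\<Sum>m\<le>degree f. coeff f m * cinner ((S ^^ m) x) y)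
       + (\<Sum>m\<le>degree f. if m = 0 then coeff f 0 * (complex_of_real (\<rho> - 1) * cinner x y) else 0)"
      unfolding sum.distrib[symmetric] by (intro sum.cong) (auto simp: L_def algebra_simps)
    thus ?thesis
      by (simp add: poly_op_def cinner_simps cinner.sum_left poly_0_coeff_0)
  qed
  finally show ?thesis
  proof (rule Lim_transform_eventually)
    show "\<forall>\<^sub>F N in sequentially. (\<Sum>m\<le>degree f. coeff f m * K m N) =
       (\<Sum>j<N. poly f (cnj (rou N ^ j)) * kernel N j x y) / of_nat N"
      using eventually_gt_at_top[of "degree f"]
    proof eventually_elim
      case (elim N)
      have "(\<Sum>j<N. poly f (cnj (rou N ^ j)) * kernel N j x y) =
          (\<Sum>m\<le>degree f. coeff f m * (\<Sum>j<N. cnj (rou N ^ j) ^ m * kernel N j x y))"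
        unfolding poly_altdef sum_distrib_right sum_distrib_left
        by (subst sum.swap) (simp only: mult.assoc)
      also have "\<dots> = (\<Sum>m\<le>degree f. coeff f m * (of_nat N * K m N))"
        using elim by (intro sum.cong refl) (simp only: kernel_average_monomial K_def atMost_iff)
      also have "\<dots> = of_nat N * (\<Sum>m\<le>degree f. coeff f m * K m N)"
        by (simp add: sum_distrib_left mult_ac)
      finally show ?case using elim by simp
    qed
  qed
qed

text \<open>As |f| is at most 1 on the circle, the average is dominated by that of
  \<open>cmod (kernel N j x y)\<close>. The AM-GM bound for each j reduces this to the diagonal
  averages, which are the case f = 1 and tend to \<rho> times the squared norm.\<close>

lemma cmod_cinner_poly_op_le:
  assumes f: "\<And>z. cmod z = 1 \<Longrightarrow> cmod (poly f z) \<le> 1"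
  shows "2 * cmod (cinner (poly_op f S x + (complex_of_real (\<rho> - 1) * poly f 0) *\<^sub>C x) y)
    \<le> \<rho> * ((norm x)\<^sup>2 + (norm y)\<^sup>2)"
proof -
  have lim1: "(\<lambda>N. Re ((\<Sum>j<N. kernel N j u u) / of_nat N)) \<longlonglongrightarrow> \<rho> * (norm u)\<^sup>2" for u
  proof -
    have "poly_op [:1:] S u + (complex_of_real (\<rho> - 1) * poly [:1:] 0) *\<^sub>C u = complex_of_real \<rho> *\<^sub>C u"
      by (simp add: poly_op_def scaleC_one scaleC.diff_left)
    thus ?thesis
      using tendsto_Re[OF kernel_average_tendsto[of "[:1:]" u u]]
      by (simp only: cinner_scaleC_left cinner_self) simp
  qed
  have lim2: "(\<lambda>N. Re ((\<Sum>j<N. kernel N j x x) / of_nat N) + Re ((\<Sum>j<N. kernel N j y y) / of_nat N))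
      \<longlonglongrightarrow> \<rho> * (norm x)\<^sup>2 + \<rho> * (norm y)\<^sup>2"
    by (intro tendsto_add lim1)
  have lim3: "(\<lambda>N. 2 * cmod ((\<Sum>j<N. poly f (cnj (rou N ^ j)) * kernel N j x y) / of_nat N))
      \<longlonglongrightarrow> 2 * cmod (cinner (poly_op f S x + (complex_of_real (\<rho> - 1) * poly f 0) *\<^sub>C x) y)"
    by (intro tendsto_mult tendsto_const tendsto_norm kernel_average_tendsto)
  have bound: "2 * cmod ((\<Sum>j<N. poly f (cnj (rou N ^ j)) * kernel N j x y) / of_nat N)
      \<le> Re ((\<Sum>j<N. kernel N j x x) / of_nat N) + Re ((\<Sum>j<N. kernel N j y y) / of_nat N)"
    if N: "0 < N" for N
  proof -
    have "2 * cmod (\<Sum>j<N. poly f (cnj (rou N ^ j)) * kernel N j x y) \<le>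
        2 * (\<Sum>j<N. cmod (kernel N j x y))"
    proof (intro mult_left_mono sum_norm_le)
      fix j
      have "cmod (poly f (cnj (rou N ^ j))) * cmod (kernel N j x y) \<le> 1 * cmod (kernel N j x y)"
        by (intro mult_right_mono f) (simp_all add: norm_power)
      thus "cmod (poly f (cnj (rou N ^ j)) * kernel N j x y) \<le> cmod (kernel N j x y)"
        by (simp add: norm_mult)
    qed simp
    also have "\<dots> \<le> (\<Sum>j<N. Re (kernel N j x x) + Re (kernel N j y y))"
      unfolding sum_distrib_left by (intro sum_mono psd_form_amgm psd_form_kernel N)
    also have "\<dots> = Re (\<Sum>j<N. kernel N j x x) + Re (\<Sum>j<N. kernel N j y y)"
      by (simp add: sum.distrib)
    finally show ?thesis using N
      by (simp add: norm_divide add_divide_distrib[symmetric] divide_right_mono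
          del: Re_sum)
  qed
  have "2 * cmod (cinner (poly_op f S x + (complex_of_real (\<rho> - 1) * poly f 0) *\<^sub>C x) y)
      \<le> \<rho> * (norm x)\<^sup>2 + \<rho> * (norm y)\<^sup>2"
    by (rule LIMSEQ_le[OF lim3 lim2], rule exI[of _ 1], intro allI impI bound) simp
  thus ?thesis by (simp add: distrib_left)
qed

lemma norm_poly_op_shifted_le:
  assumes f: "\<And>z. cmod z = 1 \<Longrightarrow> cmod (poly f z) \<le> 1"
  shows "norm (poly_op f S x + (complex_of_real (\<rho> - 1) * poly f 0) *\<^sub>C x) \<le> \<rho> * norm x"
proof -
  define y where "y = poly_op f S x + (complex_of_real (\<rho> - 1) * poly f 0) *\<^sub>C x"
  \<comment> \<open>Testing against y / \<rho> makes the two terms on the right equal when norm y =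
    \<rho> norm x, so the AM-GM bound loses nothing.\<close>
  define t where "t = 1 / \<rho>"
  have "2 * cmod (cinner y (complex_of_real t *\<^sub>C y)) \<le> \<rho> * ((norm x)\<^sup>2 + (norm (complex_of_real t *\<^sub>C y))\<^sup>2)"
    using cmod_cinner_poly_op_le[OF f, of x "complex_of_real t *\<^sub>C y"] by (simp add: y_def)
  hence "2 * (t * (norm y)\<^sup>2) \<le> \<rho> * ((norm x)\<^sup>2 + (t * norm y)\<^sup>2)"
    using \<rho> unfolding norm_scaleC
    by (simp add: cinner_scaleC_right cinner_self norm_mult norm_power norm_divide t_def)
  hence "(norm y)\<^sup>2 \<le> (\<rho> * norm x)\<^sup>2"
    using \<rho> by (simp add: t_def field_simps power2_eq_square)
  hence "norm y \<le> \<rho> * norm x" by (rule power2_le_imp_le) (use \<rho> in simp)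
  thus ?thesis by (simp add: y_def)
qed

end


subsection \<open>The extremal argument\<close>

text \<open>With d = e - cnj e * w^2 one has Re (cnj w * d) = (1 - |w|^2) Re (cnj w * e): the
  first-order change of |w|^2 vanishes on the unit circle and, for |e| at most 1/2, fits into the
  gap 1 - |w|^2. Only |d|^2, which is at most 4 |e|^2, is left.\<close>

lemma cmod_variation_sq_le:
  assumes w: "cmod w \<le> 1" and e: "cmod e \<le> 1 / 2"
  shows "(cmod (w + e - cnj e * w\<^sup>2))\<^sup>2 \<le> 1 + 4 * (cmod e)\<^sup>2"
proof -
  define a where "a = cmod w"
  define d where "d = e - cnj e * w\<^sup>2"
  have a: "0 \<le> a" "a \<le> 1" using w by (simp_all add: a_def)
  have d: "(cmod d)\<^sup>2 \<le> 4 * (cmod e)\<^sup>2"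
  proof -
    have "cmod d \<le> cmod e + cmod e * a\<^sup>2"
      unfolding d_def a_def by (metis norm_triangle_ineq4 norm_mult norm_power complex_mod_cnj)
    also have "\<dots> \<le> cmod e + cmod e * 1"
      using a by (intro add_left_mono mult_left_mono) (simp_all add: power_le_one)
    finally have "(cmod d)\<^sup>2 \<le> (2 * cmod e)\<^sup>2" by (intro power_mono) auto
    thus ?thesis by (simp add: power_mult_distrib)
  qed
  have aa: "complex_of_real (a\<^sup>2) = w * cnj w"
    unfolding a_def by (rule complex_norm_square)
  have "cnj w * d = cnj w * e - cnj (cnj w * e) * complex_of_real (a\<^sup>2)"
    unfolding aa by (simp add: d_def power2_eq_square algebra_simps)
  hence "Re (cnj w * d) = Re (cnj w * e - cnj (cnj w * e) * complex_of_real (a\<^sup>2))"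
    by (rule arg_cong)
  also have "\<dots> = (1 - a\<^sup>2) * Re (cnj w * e)"
    by (simp add: left_diff_distrib mult.commute del: of_real_power)
  also have "\<dots> \<le> (1 - a\<^sup>2) * (a * cmod e)"
    using a complex_Re_le_cmod[of "cnj w * e"]
    by (intro mult_left_mono) (simp_all add: a_def norm_mult power_le_one)
  also have "\<dots> \<le> (1 - a\<^sup>2) * (1 * (1 / 2))"
    using a e by (intro mult_left_mono mult_mono) (simp_all add: power_le_one)
  finally have re: "2 * Re (cnj w * d) \<le> 1 - a\<^sup>2" by simp
  have "(cmod (w + d))\<^sup>2 = a\<^sup>2 + 2 * Re (cnj w * d) + (cmod d)\<^sup>2"
    unfolding a_def cmod_power2 by (simp add: power2_eq_square algebra_simps)
  with re d have "(cmod (w + d))\<^sup>2 \<le> 1 + 4 * (cmod e)\<^sup>2" by linarith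
  thus ?thesis by (simp add: d_def add_diff_eq)
qed

text \<open>If \<open>f\<close> and \<open>x\<close> are almost extremal, comparing \<open>f\<close> with the variations
  \<open>f + e - cnj e * f\<^sup>2\<close>, which agree to first order with Moebius transforms of \<open>f\<close>, shows that
  \<open>f(S) x\<close> is almost orthogonal to \<open>x\<close>.\<close>
lemma near_extremal_orthogonal:
  fixes S :: "'a::complex_inner \<Rightarrow> 'a"
  assumes S: "bounded_clinear S" and K: "1 < K"
    and bound: "\<And>g y. (\<And>z. cmod z \<le> 1 \<Longrightarrow> cmod (poly g z) \<le> 1) \<Longrightarrow> norm (poly_op g S y) \<le> K * norm y"
    and f: "\<And>z. cmod z \<le> 1 \<Longrightarrow> cmod (poly f z) \<le> 1"
    and x: "norm x = 1" and \<eta>: "0 < \<eta>" "\<eta> \<le> 1 / 2"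
    and near: "K\<^sup>2 - \<eta>\<^sup>2 \<le> (norm (poly_op f S x))\<^sup>2"
  shows "cmod (cinner (poly_op f S x) x) * (2 * (K\<^sup>2 - 1)) \<le> \<eta> * (K ^ 4 + 4 * K\<^sup>2 + 2)"
proof -
  define F where "F = poly_op f S"
  define c where "c = cinner (F x) x"
  note lin = bounded_clinear_poly_op[OF S, of f, folded F_def]
  have F: "norm (F y) \<le> K * norm y" for y unfolding F_def by (rule bound[OF f])
  \<comment> \<open>The form of K^2 - F* F, positive because F has norm at most K. Near extremality
    makes B x x small, so x is almost an eigenvector of F* F for the eigenvalue K^2.\<close>
  define B where "B u v = complex_of_real (K\<^sup>2) * cinner u v - cinner (F u) (F v)" for u v
  have B: "psd_form B" unfolding psd_form_def B_def
  proof (intro conjI allI)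
    fix u v w and a :: complex
    show "complex_of_real (K\<^sup>2) * cinner u v - cinner (F u) (F v) =
        cnj (complex_of_real (K\<^sup>2) * cinner v u - cinner (F v) (F u))"
      unfolding complex_cnj_diff complex_cnj_mult complex_cnj_complex_of_real
      by (simp only: cinner_commute[symmetric])
    have "(norm (F u))\<^sup>2 \<le> (K * norm u)\<^sup>2" by (intro power_mono F) simp
    thus "0 \<le> Re (complex_of_real (K\<^sup>2) * cinner u u - cinner (F u) (F u))"
      by (simp add: cinner_self power_mult_distrib del: of_real_power)
  qed (simp_all add: clinear_add[OF lin] clinear_scaleC[OF lin] cinner_simps algebra_simps)
  have Bxx: "Re (B x x) \<le> \<eta>\<^sup>2"
    using near x by (simp add: B_def F_def cinner_self del: of_real_power)
  have BFF: "Re (B (F x) (F x)) \<le> K ^ 4"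
  proof -
    have "Re (B (F x) (F x)) \<le> K\<^sup>2 * (norm (F x))\<^sup>2"
      by (simp add: B_def cinner_self del: of_real_power)
    also have "\<dots> \<le> K\<^sup>2 * (K * norm x)\<^sup>2" by (intro mult_left_mono power_mono F) auto
    finally show ?thesis using x by (simp add: power2_eq_square power4_eq_xxxx)
  qed
  \<comment> \<open>The weight \<eta> on F x brings both terms of the AM-GM bound to order
    \<eta>^2.\<close>
  have BF: "2 * cmod (B (F x) x) \<le> \<eta> * (1 + K ^ 4)"
  proof -
    have "2 * cmod (B (complex_of_real \<eta> *\<^sub>C F x) x) \<le>
        Re (B (complex_of_real \<eta> *\<^sub>C F x) (complex_of_real \<eta> *\<^sub>C F x)) + Re (B x x)"
      by (rule psd_form_amgm[OF B])
    moreover have "B (complex_of_real \<eta> *\<^sub>C u) v = complex_of_real \<eta> * B u v" for u v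
      using B unfolding psd_form_def by blast
    ultimately have "2 * (\<eta> * cmod (B (F x) x)) \<le> \<eta> * (\<eta> * Re (B (F x) (F x))) + Re (B x x)"
      using \<eta> by (simp add: psd_form_scaleC_right[OF B] norm_mult)
    also have "\<dots> \<le> \<eta> * (\<eta> * K ^ 4) + \<eta>\<^sup>2"
      using \<eta> Bxx BFF by (intro add_mono mult_left_mono) auto
    finally have "\<eta> * (2 * cmod (B (F x) x)) \<le> \<eta> * (\<eta> * (1 + K ^ 4))"
      by (simp add: power2_eq_square algebra_simps)
    thus ?thesis using \<eta> by (simp only: mult_le_cancel_left_pos)
  qed
  \<comment> \<open>The phase makes cnj e * c equal to -\<eta> |c|, so that the variation increases
    the norm to first order by a multiple of (K^2 - 1) \<eta> |c|.\<close>
  define e where "e = - complex_of_real \<eta> * sgn c"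
  have e: "cmod e \<le> \<eta>" using \<eta> by (simp add: e_def norm_mult norm_sgn)
  hence e2: "(cmod e)\<^sup>2 \<le> \<eta>\<^sup>2" by (intro power_mono) auto
  have ec: "cnj e * c = - complex_of_real (\<eta> * cmod c)"
  proof (cases "c = 0")
    case False
    have "cnj e * c = - complex_of_real \<eta> * (c * cnj c) / complex_of_real (cmod c)"
      by (simp add: e_def sgn_eq)
    also have "\<dots> = - complex_of_real (\<eta> * (cmod c)\<^sup>2 / cmod c)"
      unfolding complex_norm_square[symmetric] by simp
    finally show ?thesis using False by (simp add: power2_eq_square)
  qed simp
  define g where "g = f + [:e:] - smult (cnj e) (f * f)"
  \<comment> \<open>Division by s brings the varied polynomial back to modulus at most 1 on the
    disc; s differs from 1 only to second order in \<eta>.\<close>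
  define s where "s = sqrt (1 + 4 * (cmod e)\<^sup>2)"
  have s: "s > 0" "s\<^sup>2 = 1 + 4 * (cmod e)\<^sup>2"
    by (auto simp: s_def add_pos_nonneg)
  have gs: "norm (poly_op g S x) \<le> s * K"
  proof -
    have "cmod (poly (smult (complex_of_real (1 / s)) g) z) \<le> 1" if "cmod z \<le> 1" for z
    proof -
      have "(cmod (poly g z))\<^sup>2 \<le> s\<^sup>2"
        using cmod_variation_sq_le[OF f[OF that], of e] e \<eta> unfolding s
        by (simp add: g_def power2_eq_square)
      hence "cmod (poly g z) \<le> s" by (rule power2_le_imp_le) (use s in simp)
      thus ?thesis using s by (simp add: norm_mult norm_divide)
    qed
    from bound[OF this, of x] show ?thesis
      using s x by (simp add: poly_op_smult norm_divide field_simps)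
  qed
  have gx: "poly_op g S x = F x + (e *\<^sub>C x - cnj e *\<^sub>C F (F x))"
  proof -
    have g: "g = f + ([:e:] + smult (- cnj e) (f * f))" by (simp add: g_def)
    have "poly_op [:e:] S x = e *\<^sub>C x"
      by (simp add: poly_op_def)
    thus ?thesis
      unfolding g poly_op_add poly_op_smult poly_op_mult[OF S]
      by (simp add: F_def scaleC.minus_left)
  qed
  have "K\<^sup>2 - \<eta>\<^sup>2 + 2 * Re (cinner (F x) (e *\<^sub>C x - cnj e *\<^sub>C F (F x))) \<le> (norm (poly_op g S x))\<^sup>2"
    using near zero_le_power2[of "norm (e *\<^sub>C x - cnj e *\<^sub>C F (F x))"]
    unfolding gx norm_add_sq F_def[symmetric] by linarith
  also have "\<dots> \<le> (s * K)\<^sup>2" using gs by (intro power_mono) auto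
  also have "\<dots> = (1 + 4 * (cmod e)\<^sup>2) * K\<^sup>2" by (simp add: power_mult_distrib s)
  also have "\<dots> \<le> (1 + 4 * \<eta>\<^sup>2) * K\<^sup>2" using e2 by (intro mult_right_mono) auto
  finally have 1: "2 * Re (cinner (F x) (e *\<^sub>C x - cnj e *\<^sub>C F (F x))) \<le> \<eta>\<^sup>2 + 4 * \<eta>\<^sup>2 * K\<^sup>2"
    by (simp add: algebra_simps)
  have "Re (cinner (F x) (e *\<^sub>C x - cnj e *\<^sub>C F (F x))) =
      Re (cnj e * c) - Re (cnj e * cinner (F (F x)) (F x))"
  proof -
    have "Re (e * cinner (F x) (F (F x))) = Re (cnj (e * cinner (F x) (F (F x))))" by simp
    also have "cnj (e * cinner (F x) (F (F x))) = cnj e * cinner (F (F x)) (F x)"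
      unfolding complex_cnj_mult by (simp only: cinner_commute[symmetric])
    finally show ?thesis by (simp add: cinner_simps c_def)
  qed
  \<comment> \<open>Here F* F x is replaced by K^2 x up to the small error B (F x) x; the
    coefficient K^2 - 1 of |c| arises from this and is positive as K > 1.\<close>
  also have "cinner (F (F x)) (F x) = complex_of_real (K\<^sup>2) * c - B (F x) x"
    by (simp add: B_def c_def)
  also have "cnj e * (complex_of_real (K\<^sup>2) * c - B (F x) x) =
      complex_of_real (K\<^sup>2) * (cnj e * c) - cnj e * B (F x) x"
    by (simp add: algebra_simps)
  finally have "Re (cinner (F x) (e *\<^sub>C x - cnj e *\<^sub>C F (F x))) =
      (K\<^sup>2 - 1) * (\<eta> * cmod c) + Re (cnj e * B (F x) x)"
    unfolding ec by (simp add: algebra_simps)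
  moreover have "- Re (cnj e * B (F x) x) \<le> \<eta> * cmod (B (F x) x)"
  proof -
    have "- Re (cnj e * B (F x) x) \<le> cmod (cnj e * B (F x) x)"
      using abs_Re_le_cmod[of "cnj e * B (F x) x"] by linarith
    also have "\<dots> \<le> \<eta> * cmod (B (F x) x)"
      unfolding norm_mult complex_mod_cnj using e by (intro mult_right_mono) auto
    finally show ?thesis .
  qed
  ultimately have "2 * ((K\<^sup>2 - 1) * (\<eta> * cmod c)) \<le> \<eta>\<^sup>2 + 4 * \<eta>\<^sup>2 * K\<^sup>2 + \<eta> * (2 * cmod (B (F x) x))"
    using 1 by linarith
  also have "\<dots> \<le> \<eta>\<^sup>2 + 4 * \<eta>\<^sup>2 * K\<^sup>2 + \<eta> * (\<eta> * (1 + K ^ 4))"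
    using BF \<eta> by (intro add_left_mono mult_left_mono) auto
  finally have "\<eta> * (cmod c * (2 * (K\<^sup>2 - 1))) \<le> \<eta> * (\<eta> * (K ^ 4 + 4 * K\<^sup>2 + 2))"
    by (simp add: algebra_simps power2_eq_square)
  hence "cmod c * (2 * (K\<^sup>2 - 1)) \<le> \<eta> * (K ^ 4 + 4 * K\<^sup>2 + 2)"
    using \<eta> by (simp only: mult_le_cancel_left_pos)
  thus ?thesis by (simp add: c_def F_def)
qed

text \<open>Let K be the supremum of norm (g(S) y) over admissible g and unit y. If K > \<rho>,
  near-extremal pairs have g(S) y almost orthogonal to y, so adding (\<rho> - 1) g(0) y hardly
  lowers the norm; the shifted bound then gives K at most \<rho>.\<close>

lemma norm_poly_op_le_if_shifted:
  fixes S :: "'a::complex_inner \<Rightarrow> 'a"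
  assumes S: "bounded_clinear S" and \<rho>: "1 \<le> \<rho>"
    and shifted: "\<And>f x. (\<And>z. cmod z \<le> 1 \<Longrightarrow> cmod (poly f z) \<le> 1) \<Longrightarrow>
        norm (poly_op f S x + (complex_of_real (\<rho> - 1) * poly f 0) *\<^sub>C x) \<le> \<rho> * norm x"
    and f: "\<And>z. cmod z \<le> 1 \<Longrightarrow> cmod (poly f z) \<le> 1"
  shows "norm (poly_op f S x) \<le> \<rho> * norm x"
proof (rule ccontr)
  assume neg: "\<not> norm (poly_op f S x) \<le> \<rho> * norm x"
  define unit where "unit g \<longleftrightarrow> (\<forall>z. cmod z \<le> 1 \<longrightarrow> cmod (poly g z) \<le> 1)" for g
  define E where "E = {norm (poly_op g S y) |g y. unit g \<and> norm y = 1}"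
  have Fx: "norm (poly_op g S (complex_of_real a *\<^sub>C y)) = \<bar>a\<bar> * norm (poly_op g S y)" for g a y
    by (simp add: clinear_scaleC[OF bounded_clinear_poly_op[OF S]])
  have bdd: "bdd_above E"
  proof (rule bdd_aboveI)
    fix t assume "t \<in> E"
    then obtain g y where g: "unit g" "norm y = 1" "t = norm (poly_op g S y)"
      by (auto simp: E_def)
    have "cmod (poly g 0) \<le> 1" using g by (simp add: unit_def)
    hence "(\<rho> - 1) * cmod (poly g 0) \<le> (\<rho> - 1) * 1" using \<rho> by (intro mult_left_mono) auto
    hence "norm ((complex_of_real (\<rho> - 1) * poly g 0) *\<^sub>C y) \<le> \<rho> - 1"
      using \<rho> g by (simp add: norm_mult del: of_real_diff)
    moreover have "norm (poly_op g S y + (complex_of_real (\<rho> - 1) * poly g 0) *\<^sub>C y) \<le> \<rho>"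
      using shifted[of g y] g by (simp add: unit_def)
    \<comment> \<open>The shifted vector contributes \<rho>, the shift itself \<rho> - 1.\<close>
    ultimately show "t \<le> 2 * \<rho> - 1"
      using norm_triangle_ineq4[of "poly_op g S y + (complex_of_real (\<rho> - 1) * poly g 0) *\<^sub>C y"
          "(complex_of_real (\<rho> - 1) * poly g 0) *\<^sub>C y"] g by simp
  qed
  define K where "K = Sup E"
  have bound: "norm (poly_op g S y) \<le> K * norm y" if "unit g" for g y
  proof (cases "y = 0")
    case True
    thus ?thesis using clinear_0[OF bounded_clinear_poly_op[OF S]] by simp
  next
    case False
    have "norm (poly_op g S (complex_of_real (1 / norm y) *\<^sub>C y)) \<in> E"
      using that False unfolding E_def by (auto intro!: exI simp: norm_divide)
    hence "norm (poly_op g S (complex_of_real (1 / norm y) *\<^sub>C y)) \<le> K"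
      unfolding K_def by (rule cSup_upper[OF _ bdd])
    thus ?thesis unfolding Fx using False by (simp add: field_simps)
  qed
  have "unit f" using f by (simp add: unit_def)
  from bound[OF this, of x] neg have K: "\<rho> < K"
    by (meson less_le_trans linorder_not_less mult_right_mono norm_ge_zero not_le)
  have "E \<noteq> {}"
  proof -
    have "x \<noteq> 0" using neg clinear_0[OF bounded_clinear_poly_op[OF S]] by auto
    hence "norm (poly_op f S (complex_of_real (1 / norm x) *\<^sub>C x)) \<in> E"
      using \<open>unit f\<close> unfolding E_def by (auto intro!: exI simp: norm_divide)
    thus ?thesis by blast
  qed
  define M where "M = (K ^ 4 + 4 * K\<^sup>2 + 2) / (2 * (K\<^sup>2 - 1))"
  have K1: "1 < K" using K \<rho> by simp
  hence K2: "1 < K\<^sup>2" by (simp add: one_less_power)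
  have ineq: "K\<^sup>2 - \<eta>\<^sup>2 - 2 * (\<rho> - 1) * (\<eta> * M) \<le> \<rho>\<^sup>2" if \<eta>: "0 < \<eta>" "\<eta> \<le> 1 / 2" for \<eta>
  proof -
    \<comment> \<open>The square of this lower bound is at least K^2 - \<eta>^2, the deficit allowed
      in \<open>near_extremal_orthogonal\<close>.\<close>
    have "K - \<eta>\<^sup>2 / (2 * K) < Sup E" using \<eta> K1 by (simp add: K_def[symmetric])
    then obtain t where t: "t \<in> E" "K - \<eta>\<^sup>2 / (2 * K) < t"
      using less_cSup_iff[OF \<open>E \<noteq> {}\<close> bdd] by blast
    then obtain g y where g: "unit g" "norm y = 1" "t = norm (poly_op g S y)"
      by (auto simp: E_def)
    let ?G = "poly_op g S y" and ?a = "complex_of_real (\<rho> - 1) * poly g 0"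
    have "\<eta>\<^sup>2 \<le> 1" using \<eta> by (intro power_le_one) auto
    hence "\<eta>\<^sup>2 / (2 * K) \<le> K" using K1 by (simp add: field_simps) (smt (verit) mult_less_cancel_left1)
    hence "(K - \<eta>\<^sup>2 / (2 * K))\<^sup>2 \<le> t\<^sup>2" using t by (intro power_mono) auto
    moreover have "(K - \<eta>\<^sup>2 / (2 * K))\<^sup>2 = K\<^sup>2 - \<eta>\<^sup>2 + (\<eta>\<^sup>2 / (2 * K))\<^sup>2"
      using K1 by (simp add: power2_diff)
    ultimately have near: "K\<^sup>2 - \<eta>\<^sup>2 \<le> (norm ?G)\<^sup>2"
      using zero_le_power2[of "\<eta>\<^sup>2 / (2 * K)"] unfolding g(3) by linarith
    have "cmod (cinner ?G y) * (2 * (K\<^sup>2 - 1)) \<le> \<eta> * (K ^ 4 + 4 * K\<^sup>2 + 2)"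
      by (rule near_extremal_orthogonal[OF S K1 _ _ g(2) \<eta> near])
        (use bound g in \<open>auto simp: unit_def\<close>)
    hence c: "cmod (cinner ?G y) \<le> \<eta> * M" using K2 by (simp add: M_def field_simps)
    have "- Re (cinner ?G (?a *\<^sub>C y)) \<le> cmod (cinner ?G (?a *\<^sub>C y))"
      using abs_Re_le_cmod[of "cinner ?G (?a *\<^sub>C y)"] by linarith
    also have "\<dots> = (\<rho> - 1) * (cmod (poly g 0) * cmod (cinner ?G y))"
      using \<rho> by (simp add: cinner_scaleC_right norm_mult del: of_real_diff)
    also have "\<dots> \<le> (\<rho> - 1) * (1 * (\<eta> * M))"
      using \<rho> g c by (intro mult_left_mono mult_mono) (auto simp: unit_def)
    finally have "- Re (cinner ?G (?a *\<^sub>C y)) \<le> (\<rho> - 1) * (\<eta> * M)" by simp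
    moreover have "(norm (?G + ?a *\<^sub>C y))\<^sup>2 \<le> \<rho>\<^sup>2"
      using shifted[of g y] g by (intro power_mono) (auto simp: unit_def)
    ultimately show ?thesis
      using near zero_le_power2[of "norm (?a *\<^sub>C y)"] unfolding norm_add_sq by linarith
  qed
  have "((\<lambda>\<eta>. K\<^sup>2 - \<eta>\<^sup>2 - 2 * (\<rho> - 1) * (\<eta> * M)) \<longlongrightarrow> K\<^sup>2 - 0\<^sup>2 - 2 * (\<rho> - 1) * (0 * M)) (at_right 0)"
    by (intro tendsto_intros)
  moreover have "\<forall>\<^sub>F \<eta> in at_right 0. K\<^sup>2 - \<eta>\<^sup>2 - 2 * (\<rho> - 1) * (\<eta> * M) \<le> \<rho>\<^sup>2"
    by (rule eventually_mono[OF eventually_at_right_real[of 0 "1/2"]]) (auto simp del: right_diff_distrib_numeral intro!: ineq)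
  ultimately have "K\<^sup>2 - 0\<^sup>2 - 2 * (\<rho> - 1) * (0 * M) \<le> \<rho>\<^sup>2"
    by (intro tendsto_upperbound) auto
  hence "K\<^sup>2 \<le> \<rho>\<^sup>2" by simp
  hence "K \<le> \<rho>" by (rule power2_le_imp_le) (use \<rho> in simp)
  thus False using K by simp
qed


subsection \<open>The deformed numerical radius\<close>

lemma deform_par_bounds:
  assumes "1 \<le> \<rho>"
  shows "0 \<le> deform_par \<rho>" "deform_par \<rho> < 2"
  using assms by (simp_all add: deform_par_def divide_le_eq)

lemma deform_par_2: "0 < \<rho> \<Longrightarrow> deform_par \<rho> = 1 \<longleftrightarrow> \<rho> = 2"
  by (auto simp: deform_par_def field_simps)

lemma exists_unit_vector:
  assumes "(UNIV :: 'a::complex_inner set) \<noteq> {0}"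
  shows "\<exists>h::'a. norm h = 1"
proof -
  obtain x :: 'a where "x \<noteq> 0" using assms by auto
  hence "norm (complex_of_real (1 / norm x) *\<^sub>C x) = 1" by (simp add: norm_divide)
  thus ?thesis by blast
qed

context
  fixes T :: "'a::complex_inner \<Rightarrow> 'a" and \<rho> :: real
  assumes T: "bounded_clinear T" and \<rho>: "1 \<le> \<rho>"
begin

lemma deform_dom_cases:
  assumes "h \<in> deform_dom \<rho> T"
  shows "norm h = 1" "cinner (T h) h \<noteq> 0 \<Longrightarrow> 0 \<le> deform_discr \<rho> T h"
proof -
  show "norm h = 1" using assms by (auto simp: deform_dom_def split: if_splits)
  assume "cinner (T h) h \<noteq> 0"
  thus "0 \<le> deform_discr \<rho> T h"
    using assms by (auto simp: deform_dom_def deform_discr_def deform_par_def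
        cinner.zero_left split: if_splits)
qed

lemma cmod_deform_point:
  assumes "h \<in> deform_dom \<rho> T" "cinner (T h) h \<noteq> 0"
  shows "cmod (complex_of_real (deform_factor \<rho> T h) * cinner (T h) h) =
    (deform_par \<rho> * cmod (cinner (T h) h) + sqrt (deform_discr \<rho> T h)) / 2"
proof -
  have "0 \<le> deform_factor \<rho> T h"
    using assms deform_dom_cases(2)[OF assms] deform_par_bounds(1)[OF \<rho>]
    by (simp add: deform_factor_def)
  thus ?thesis using assms by (simp add: norm_mult) (simp add: deform_factor_def field_simps)
qed

text \<open>Makes the supremum defining the radius a genuine one. The points lie in a closed ball,
  which is convex and therefore absorbs both the closure and the hull.\<close>

lemma bdd_above_deformed_range: "bdd_above (cmod ` deformed_numerical_range \<rho> T)"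
proof -
  obtain K where K: "K > 0" "\<And>x. norm (T x) \<le> norm x * K"
    using bounded_linear.pos_bounded[OF clinear_bounded_linear[OF T]] by blast
  have *: "cmod (complex_of_real (deform_factor \<rho> T h) * cinner (T h) h) \<le> 3 * K"
    if h: "h \<in> deform_dom \<rho> T" for h
  proof (cases "cinner (T h) h = 0")
    case False
    have n: "norm h = 1" by (rule deform_dom_cases(1)[OF h])
    have b: "norm (T h) \<le> K" using K(2)[of h] n by simp
    have a: "cmod (cinner (T h) h) \<le> K" using cmod_cinner_le[of "T h" h] n b by simp
    note r = deform_par_bounds[OF \<rho>]
    have "deform_discr \<rho> T h \<le> 4 * K\<^sup>2 + 4 * K\<^sup>2"
    proof -
      have "(deform_par \<rho>)\<^sup>2 * (cmod (cinner (T h) h))\<^sup>2 \<le> 2\<^sup>2 * K\<^sup>2"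
        using a r by (intro mult_mono power_mono) auto
      moreover have "(4 * (1 - deform_par \<rho>)) * (norm (T h))\<^sup>2 \<le> 4 * K\<^sup>2"
      proof -
        have "(norm (T h))\<^sup>2 \<le> K\<^sup>2" using b by (intro power_mono) auto
        moreover have "(4 * (1 - deform_par \<rho>)) * (norm (T h))\<^sup>2 \<le> 4 * (norm (T h))\<^sup>2"
          using r by (intro mult_right_mono) auto
        ultimately show ?thesis by linarith
      qed
      ultimately show ?thesis by (simp add: deform_discr_def algebra_simps)
    qed
    hence "sqrt (deform_discr \<rho> T h) \<le> sqrt ((4 * K)\<^sup>2)"
      by (intro real_sqrt_le_mono order_trans[OF \<open>deform_discr \<rho> T h \<le> _\<close>]) (simp add: power_mult_distrib)
    hence "sqrt (deform_discr \<rho> T h) \<le> 4 * K" unfolding real_sqrt_abs using K by simp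
    moreover have "deform_par \<rho> * cmod (cinner (T h) h) \<le> 2 * K"
      using a r by (intro mult_mono) auto
    ultimately show ?thesis unfolding cmod_deform_point[OF h False] by simp
  qed (use K in simp)
  have "deformed_numerical_range \<rho> T \<subseteq> cball 0 (3 * K)"
    unfolding deformed_numerical_range_def
    by (intro hull_minimal closure_minimal) (auto simp: *)
  thus ?thesis by (intro bdd_aboveI[of _ "3 * K"]) auto
qed

lemma cmod_deform_point_le:
  assumes "h \<in> deform_dom \<rho> T"
  shows "cmod (complex_of_real (deform_factor \<rho> T h) * cinner (T h) h) \<le> deformed_numerical_radius \<rho> T"
  unfolding deformed_numerical_radius_def
proof (rule cSUP_upper[OF _ bdd_above_deformed_range])
  show "complex_of_real (deform_factor \<rho> T h) * cinner (T h) h \<in> deformed_numerical_range \<rho> T"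
    unfolding deformed_numerical_range_def
    by (rule hull_inc, rule subsetD[OF closure_subset]) (use assms in blast)
qed

text \<open>If the domain were empty, \<open>T\<close> would be injective with \<open>\<bar>\<langle>T h, h\<rangle>\<bar> \<le> c \<parallel>T h\<parallel> \<parallel>h\<parallel>\<close> for some
  \<open>c < 1\<close>; then the resolvents \<open>(1 - z T)\<^sup>-\<^sup>1\<close> would be bounded uniformly in \<open>z\<close>, forcing \<open>T = 0\<close>.\<close>
lemma deform_dom_nonempty:
  assumes "(UNIV :: 'a set) \<noteq> {0}"
  shows "deform_dom \<rho> T \<noteq> {}"
proof
  assume empty: "deform_dom \<rho> T = {}"
  define r where "r = deform_par \<rho>"
  obtain h0 :: 'a where h0: "norm h0 = 1" using exists_unit_vector[OF assms] by blast
  have r2: "\<rho> \<noteq> 2" using empty h0 by (auto simp: deform_dom_def)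
  have neg: "r\<^sup>2 * (cmod (cinner (T h) h))\<^sup>2 \<le> 4 * (r - 1) * (norm (T h))\<^sup>2" "T h \<noteq> 0"
    if "norm h = 1" for h
    using empty that r2 by (auto simp: deform_dom_def deform_discr_def r_def set_eq_iff not_less)
  have "0 \<le> 4 * (r - 1) * (norm (T h0))\<^sup>2"
    by (rule order_trans[OF _ neg(1)[OF h0]]) simp
  hence "1 \<le> r" using neg(2)[OF h0] by (simp add: zero_le_mult_iff)
  moreover have "r \<noteq> 1" using deform_par_2[of \<rho>] r2 \<rho> by (simp add: r_def)
  ultimately have r: "1 < r" "r < 2" using deform_par_bounds(2)[OF \<rho>] by (auto simp: r_def)
  \<comment> \<open>The square of the constant c above: emptiness gives |<T h, h>|^2 at most c2
    (norm (T h))^2, and c2 < 1 amounts to (r - 2)^2 > 0.\<close>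
  define c2 where "c2 = 4 * (r - 1) / r\<^sup>2"
  have "4 * (r - 1) < r\<^sup>2"
    using zero_less_power2[of "r - 2"] r by (simp add: power2_eq_square algebra_simps)
  hence c2: "0 < c2" "c2 < 1" using r by (simp_all add: c2_def)
  define C where "C = 1 / sqrt (1 - c2)"
  have C: "0 < C" using c2 by (simp add: C_def)
  have unit: "1 \<le> C * norm (h - z *\<^sub>C T h)" if h: "norm h = 1" for h z
  proof -
    define a b s where "a = cmod (cinner (T h) h)" and "b = norm (T h)" and "s = cmod z"
    have ab: "a\<^sup>2 / c2 \<le> b\<^sup>2"
      using neg(1)[OF h] r c2 by (simp add: c2_def a_def b_def field_simps)
    have "cmod (cinner h (z *\<^sub>C T h)) = s * a"
      by (simp add: cinner_scaleC_right norm_mult s_def a_def)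
        (metis cinner_commute complex_mod_cnj)
    hence re: "Re (cinner h (z *\<^sub>C T h)) \<le> s * a"
      by (metis complex_Re_le_cmod)
    \<comment> \<open>Completing the square gives a lower bound independent of z, hence a resolvent
      bound on discs of every radius.\<close>
    have "1 - c2 \<le> 1 - c2 + (c2 - s * a)\<^sup>2 / c2" using c2 by simp
    also have "\<dots> = 1 - 2 * (s * a) + s\<^sup>2 * (a\<^sup>2 / c2)"
      using c2 by (simp add: power2_eq_square field_simps)
    also have "\<dots> \<le> 1 - 2 * (s * a) + s\<^sup>2 * b\<^sup>2"
      using ab by (intro add_left_mono mult_left_mono) auto
    also have "\<dots> \<le> (norm (h - z *\<^sub>C T h))\<^sup>2"
      unfolding norm_diff_sq using re h by (simp add: s_def b_def power_mult_distrib)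
    finally have "sqrt (1 - c2) \<le> sqrt ((norm (h - z *\<^sub>C T h))\<^sup>2)"
      by (rule real_sqrt_le_mono)
    thus ?thesis using c2 by (simp add: C_def field_simps)
  qed
  have res: "resolvent_bound T C s" for s
    unfolding resolvent_bound_def
  proof (intro allI impI)
    fix z h
    show "norm h \<le> C * norm (h - z *\<^sub>C T h)"
    proof (cases "h = 0")
      case False
      define t where "t = complex_of_real (1 / norm h)"
      have "t *\<^sub>C h - z *\<^sub>C T (t *\<^sub>C h) = t *\<^sub>C (h - z *\<^sub>C T h)"
        by (simp add: clinear_scaleC[OF T] scaleC.diff_right scaleC_scaleC mult.commute)
      moreover have t: "cmod t = 1 / norm h" by (simp add: t_def norm_divide)
      ultimately have "1 \<le> C * (norm (h - z *\<^sub>C T h) / norm h)"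
        using unit[of "t *\<^sub>C h" z] False by simp
      thus ?thesis using False by (simp add: field_simps)
    qed (use C in simp)
  qed
  \<comment> \<open>Large enough to contradict \<open>s * norm (T h0) \<le> C\<close>.\<close>
  define s where "s = (C + 1) / norm (T h0)"
  have s: "0 \<le> s" "s * norm (T h0) = C + 1" using C neg(2)[OF h0] by (auto simp: s_def)
  have "s ^ 1 * norm ((T ^^ 1) h0) \<le> C * norm h0"
    using powers_vanish_if_resolvent_bound[OF T _ res s(1)] C
    by (intro norm_funpow_le[OF T _ res s(1)]) auto
  thus False using s h0 by simp
qed

lemma deformed_radius_nonneg:
  assumes "(UNIV :: 'a set) \<noteq> {0}"
  shows "0 \<le> deformed_numerical_radius \<rho> T"
  using deform_dom_nonempty[OF assms] cmod_deform_point_le by (meson all_not_in_conv norm_ge_zero order_trans)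

section \<open>Positivity of the homogenized quadratic form\<close>

definition deform_form :: "real \<Rightarrow> 'a \<Rightarrow> real" where
  "deform_form u h = u\<^sup>2 * (norm h)\<^sup>2 - deform_par \<rho> * u * cmod (cinner (T h) h)
     + (deform_par \<rho> - 1) * (norm (T h))\<^sup>2"

text \<open>After normalizing h, a nonpositive discriminant makes the quadratic in u nonnegative
  everywhere. Otherwise the unit vector lies in the domain, and u exceeds the modulus of its point,
  which is the larger root.\<close>

lemma deform_form_nonneg_generic:
  assumes u: "deformed_numerical_radius \<rho> T < u" and h: "cinner (T h) h \<noteq> 0"
  shows "0 \<le> deform_form u h"
proof -
  define k where "k = complex_of_real (1 / norm h) *\<^sub>C h"
  have h0: "h \<noteq> 0" using h by (auto simp: cinner.zero_right)
  have k: "norm k = 1" using h0 by (simp add: k_def norm_divide)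
  have Tk: "norm (T k) = norm (T h) / norm h"
    by (simp add: k_def clinear_scaleC[OF T] norm_divide)
  have ck: "cmod (cinner (T k) k) = cmod (cinner (T h) h) / (norm h)\<^sup>2"
    by (simp add: k_def clinear_scaleC[OF T] cinner_simps norm_mult norm_divide power2_eq_square)
  have ck0: "cinner (T k) k \<noteq> 0"
    using ck h h0 by (metis divide_eq_0_iff norm_eq_zero power_eq_0_iff)
  define a b r where "a = cmod (cinner (T k) k)" and "b = norm (T k)" and "r = deform_par \<rho>"
  have D: "u\<^sup>2 - r * u * a + (r - 1) * b\<^sup>2 = (u - r * a / 2)\<^sup>2 - deform_discr \<rho> T k / 4"
    by (simp add: deform_discr_def a_def[symmetric] b_def[symmetric] r_def[symmetric])
      (simp add: power2_eq_square field_simps)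
  have "0 \<le> u\<^sup>2 - r * u * a + (r - 1) * b\<^sup>2"
  proof (cases "deform_discr \<rho> T k \<le> 0")
    case True
    thus ?thesis unfolding D using zero_le_power2[of "u - r * a / 2"] by linarith
  next
    case False
    hence dom: "k \<in> deform_dom \<rho> T" using k by (auto simp: deform_dom_def)
    have "(r * a + sqrt (deform_discr \<rho> T k)) / 2 < u"
      using cmod_deform_point_le[OF dom] u unfolding cmod_deform_point[OF dom ck0]
      by (simp add: a_def r_def)
    hence "sqrt (deform_discr \<rho> T k) / 2 \<le> u - r * a / 2" by (simp add: field_simps)
    hence "(sqrt (deform_discr \<rho> T k) / 2)\<^sup>2 \<le> (u - r * a / 2)\<^sup>2"
      using False by (intro power_mono) auto
    thus ?thesis unfolding D using False by (simp add: power_divide)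
  qed
  hence "0 \<le> (norm h)\<^sup>2 * (u\<^sup>2 - r * u * a + (r - 1) * b\<^sup>2)" by simp
  also have "\<dots> = deform_form u h"
    using h0 by (simp add: a_def b_def r_def Tk ck deform_form_def field_simps)
  finally show ?thesis .
qed

text \<open>Vectors with \<open>\<langle>T h, h\<rangle> = 0\<close> contribute only \<open>0\<close> to the deformed range whatever \<open>\<parallel>T h\<parallel>\<close> is; for
  these the inequality is recovered by perturbing \<open>h\<close> in the direction \<open>T h\<close>.\<close>
lemma deform_form_nonneg:
  assumes u: "deformed_numerical_radius \<rho> T < u"
  shows "0 \<le> deform_form u h"
proof (rule ccontr)
  assume neg: "\<not> 0 \<le> deform_form u h"
  define q where "q x = cinner (T x) x" for x
  define y where "y t = h + t *\<^sub>C T h" for t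
  have q0: "q h = 0"
    using deform_form_nonneg_generic[OF u, of h] neg by (auto simp: q_def)
  have Tlim: "(\<lambda>t. T (y t)) \<midarrow>0\<rightarrow> T (y 0)" and ylim: "y \<midarrow>0\<rightarrow> y 0"
  proof -
    show "y \<midarrow>0\<rightarrow> y 0" unfolding y_def[abs_def]
      by (intro tendsto_intros scaleC.tendsto)
    thus "(\<lambda>t. T (y t)) \<midarrow>0\<rightarrow> T (y 0)"
      by (rule bounded_linear.tendsto[OF clinear_bounded_linear[OF T]])
  qed
  have "(\<lambda>t. deform_form u (y t)) \<midarrow>0\<rightarrow> deform_form u (y 0)"
    unfolding deform_form_def by (intro tendsto_intros cinner.tendsto Tlim ylim)
  moreover have "deform_form u (y 0) < 0" using neg by (simp add: y_def scaleC.zero_left)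
  ultimately have "\<forall>\<^sub>F t in at 0. deform_form u (y t) < 0"
    by (rule order_tendstoD(2))
  then obtain d where d: "d > 0" "\<And>t. t \<noteq> 0 \<Longrightarrow> dist t 0 < d \<Longrightarrow> deform_form u (y t) < 0"
    unfolding eventually_at by auto
  \<comment> \<open>By continuity the form stays negative near h, and negative values occur only
    where q vanishes.\<close>
  have qy: "q (y t) = 0" if "t \<noteq> 0" "cmod t < d" for t
    using deform_form_nonneg_generic[OF u, of "y t"] d(2)[of t] that by (force simp: q_def)
  define A B E where "A = cinner (T (T h)) h" and "B = cinner (T h) (T h)" and "E = q (T h)"
  have expand: "q (y t) = cnj t * B + t * A + t * cnj t * E" for t
    using q0 by (simp add: q_def y_def A_def B_def E_def clinear_add[OF T] clinear_scaleC[OF T]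
        cinner_simps algebra_simps)
  \<comment> \<open>The values t = s, -s and \<i> s separate the terms: the first two force s E = 0
    and A = -B, the third then B = 0, that is T h = 0.\<close>
  define s where "s = complex_of_real (d / 2)"
  have s: "s \<noteq> 0" "cnj s = s" "cmod s < d" using d(1) by (simp_all add: s_def norm_divide)
  have 1: "s * (B + A + s * E) = 0"
    using qy[of s] s unfolding expand by (simp add: algebra_simps)
  have 2: "s * (- B - A + s * E) = 0"
    using qy[of "- s"] s unfolding expand by (simp add: algebra_simps)
  have 3: "s * (- \<i> * B + \<i> * A + s * E) = 0"
    using qy[of "\<i> * s"] s unfolding expand by (simp add: norm_mult algebra_simps)
  have 4: "B + A + s * E = 0" "- B - A + s * E = 0" "- \<i> * B + \<i> * A + s * E = 0"
    using 1 2 3 s(1) by simp_all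
  have "2 * (s * E) = (B + A + s * E) + (- B - A + s * E)" by simp
  hence sE: "s * E = 0" unfolding 4 by simp
  hence AB: "A = - B" using 4(1) unfolding sE by (simp add: eq_neg_iff_add_eq_0 add.commute)
  have "- \<i> * B - \<i> * B = 0" using 4(3) sE AB by simp
  hence "B = 0" by simp
  hence "T h = 0" by (simp add: B_def cinner_eq_zero_iff)
  hence "deform_form u h = u\<^sup>2 * (norm h)\<^sup>2" by (simp add: deform_form_def cinner.zero_left)
  thus False using neg by simp
qed

text \<open>This is |z|^2 times \<open>deform_form\<close> at u = 1 / |z|, which is at least R; as r
  is nonnegative, passing from the modulus to the real part only increases the expression.\<close>

lemma deformed_radius_kernel_nonneg:
  assumes R: "deformed_numerical_radius \<rho> T < R" "0 < R" and z: "cmod z * R \<le> 1"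
  shows "0 \<le> (norm h)\<^sup>2 - deform_par \<rho> * Re (cinner (z *\<^sub>C T h) h)
    + (deform_par \<rho> - 1) * (norm (z *\<^sub>C T h))\<^sup>2"
proof (cases "z = 0")
  case False
  define s where "s = cmod z"
  have s: "0 < s" using False by (simp add: s_def)
  have "deformed_numerical_radius \<rho> T < 1 / s"
    using R z s by (intro less_le_trans[OF R(1)]) (simp add: s_def field_simps)
  hence "0 \<le> s\<^sup>2 * deform_form (1 / s) h" using deform_form_nonneg by simp
  also have "\<dots> = (norm h)\<^sup>2 - deform_par \<rho> * (s * cmod (cinner (T h) h))
      + (deform_par \<rho> - 1) * (s * norm (T h))\<^sup>2"
    using s by (simp add: deform_form_def power2_eq_square field_simps)
  also have "\<dots> \<le> (norm h)\<^sup>2 - deform_par \<rho> * Re (cinner (z *\<^sub>C T h) h)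
      + (deform_par \<rho> - 1) * (s * norm (T h))\<^sup>2"
  proof -
    have "Re (cinner (z *\<^sub>C T h) h) \<le> s * cmod (cinner (T h) h)"
      using complex_Re_le_cmod[of "cinner (z *\<^sub>C T h) h"]
      by (simp only: cinner_scaleC_left norm_mult s_def)
    thus ?thesis using deform_par_bounds(1)[OF \<rho>] by (simp add: mult_left_mono)
  qed
  finally show ?thesis by (simp add: s_def)
qed (simp add: scaleC.zero_left cinner.zero_left)

end


subsection \<open>The inequality\<close>

text \<open>The inequality is used at z / \<kappa>, outside the unit disc when |z| > \<kappa>.
  Substituting z S h = h - x with x = (1 - z S) h turns it into D |h|^2 \<le> E Re <x, h> + G |x|^2,
  which bounds h by x once D > 0.\<close>

lemma resolvent_bound_if_margin:
  fixes S :: "'a::complex_inner \<Rightarrow> 'a"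
  assumes \<kappa>: "0 < \<kappa>" "\<kappa> < 1" "r - 1 < \<kappa>"
    and ker: "\<And>z h. cmod z * \<kappa> \<le> 1 \<Longrightarrow>
      0 \<le> (norm h)\<^sup>2 - r * Re (cinner (z *\<^sub>C S h) h) + (r - 1) * (norm (z *\<^sub>C S h))\<^sup>2"
  shows "\<exists>C\<ge>0. resolvent_bound S C 1"
proof -
  define \<sigma> where "\<sigma> = 1 / \<kappa>"
  \<comment> \<open>D factors 1 - r \<sigma> + (r - 1) \<sigma>^2 up to sign; its factors are
    positive by \<open>\<kappa> < 1\<close> and \<open>r - 1 < \<kappa>\<close>
    respectively.\<close>
  define D E G where "D = (\<sigma> - 1) * (1 - (r - 1) * \<sigma>)" and "E = r * \<sigma> - 2 * (r - 1) * \<sigma>\<^sup>2"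
    and "G = (r - 1) * \<sigma>\<^sup>2"
  have D: "0 < D" using \<kappa> by (simp add: D_def \<sigma>_def)
  define C where "C = (\<bar>E\<bar> + \<bar>G\<bar>) / D + 1"
  have C: "1 \<le> C" using D by (simp add: C_def)
  have "resolvent_bound S C 1" unfolding resolvent_bound_def
  proof (intro allI impI)
    fix z h assume z: "cmod z \<le> 1"
    define v x where "v = z *\<^sub>C S h" and "x = h - v"
    define n m where "n = norm h" and "m = norm x"
    have nm: "0 \<le> n" "0 \<le> m" by (simp_all add: n_def m_def)
    have \<sigma>v: "(complex_of_real \<sigma> * z) *\<^sub>C S h = complex_of_real \<sigma> *\<^sub>C v"
      by (simp add: v_def scaleC_scaleC)
    have "cmod (complex_of_real \<sigma> * z) * \<kappa> \<le> 1"
      using z \<kappa> by (simp add: norm_mult \<sigma>_def norm_divide)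
    from ker[OF this, of h] have "0 \<le> n\<^sup>2 - r * (\<sigma> * Re (cinner v h)) + (r - 1) * (\<sigma> * norm v)\<^sup>2"
      unfolding \<sigma>v using \<kappa> by (simp add: cinner_scaleC_left n_def \<sigma>_def norm_divide)
    moreover have "(norm v)\<^sup>2 = n\<^sup>2 - 2 * Re (cinner x h) + m\<^sup>2"
    proof -
      have "Re (cinner h x) = Re (cinner x h)" by (subst cinner_commute) simp
      moreover have "v = h - x" by (simp add: x_def)
      ultimately show ?thesis by (simp add: norm_diff_sq n_def m_def)
    qed
    moreover have "Re (cinner v h) = n\<^sup>2 - Re (cinner x h)"
      by (simp add: x_def cinner_simps cinner_self n_def del: of_real_power)
    ultimately have "0 \<le> n\<^sup>2 - r * (\<sigma> * (n\<^sup>2 - Re (cinner x h)))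
        + (r - 1) * (\<sigma>\<^sup>2 * (n\<^sup>2 - 2 * Re (cinner x h) + m\<^sup>2))"
      by (simp add: power_mult_distrib)
    hence "D * n\<^sup>2 \<le> E * Re (cinner x h) + G * m\<^sup>2"
      by (simp add: D_def E_def G_def algebra_simps power2_eq_square)
    also have "E * Re (cinner x h) \<le> \<bar>E\<bar> * (m * n)"
    proof -
      have "E * Re (cinner x h) \<le> \<bar>E\<bar> * \<bar>Re (cinner x h)\<bar>"
        by (metis abs_ge_self abs_mult)
      also have "\<dots> \<le> \<bar>E\<bar> * (m * n)"
        using abs_Re_le_cmod[of "cinner x h"] cmod_cinner_le[of x h]
        by (intro mult_left_mono) (simp_all add: m_def n_def)
      finally show ?thesis .
    qed
    also have "G * m\<^sup>2 \<le> \<bar>G\<bar> * m\<^sup>2" by (intro mult_right_mono) auto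
    finally have main: "D * n\<^sup>2 \<le> \<bar>E\<bar> * (m * n) + \<bar>G\<bar> * m\<^sup>2" by simp
    have "n \<le> C * m"
    \<comment> \<open>For n > m the term m^2 is at most m n, so one factor n cancels.\<close>
    proof (cases "n \<le> m")
      case True
      thus ?thesis using C nm mult_right_mono[of 1 C m] by simp
    next
      case False
      have "m\<^sup>2 \<le> m * n" using False nm by (simp add: power2_eq_square mult_left_mono)
      hence "\<bar>G\<bar> * m\<^sup>2 \<le> \<bar>G\<bar> * (m * n)" by (intro mult_left_mono) auto
      with main have "n * (D * n) \<le> n * ((\<bar>E\<bar> + \<bar>G\<bar>) * m)"
        by (simp add: algebra_simps power2_eq_square)
      hence "D * n \<le> (\<bar>E\<bar> + \<bar>G\<bar>) * m"
        using False nm by (simp add: mult_le_cancel_left_pos)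
      hence "n \<le> (\<bar>E\<bar> + \<bar>G\<bar>) / D * m" using D by (simp add: field_simps)
      thus ?thesis using nm by (simp add: C_def algebra_simps)
    qed
    thus "norm h \<le> C * norm (h - z *\<^sub>C S h)" by (simp add: n_def m_def x_def v_def)
  qed
  thus ?thesis using C by (intro exI[of _ C]) auto
qed

text \<open>Expansion yields \<rho> / 2 times the kernel inequality, because r = 2 (\<rho> - 1) /
  \<rho> and r - 1 = (\<rho> - 2) / \<rho>.\<close>

lemma resolvent_positive_if_kernel:
  fixes S :: "'a::complex_inner \<Rightarrow> 'a"
  assumes \<rho>: "1 \<le> \<rho>"
    and ker: "\<And>z h. cmod z = 1 \<Longrightarrow> 0 \<le> (norm h)\<^sup>2 - deform_par \<rho> * Re (cinner (z *\<^sub>C S h) h)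
      + (deform_par \<rho> - 1) * (norm (z *\<^sub>C S h))\<^sup>2"
  shows "resolvent_positive \<rho> S"
  unfolding resolvent_positive_def
proof (intro allI impI)
  fix z h assume z: "cmod z = 1"
  define v where "v = z *\<^sub>C S h"
  have "Re (cinner h v) = Re (cinner v h)" by (subst cinner_commute) simp
  hence "Re (cinner (h + complex_of_real ((\<rho> - 2) / 2) *\<^sub>C (h - v)) (h - v)) =
      \<rho> / 2 * (norm h)\<^sup>2 - (\<rho> - 1) * Re (cinner v h) + (\<rho> - 2) / 2 * (norm v)\<^sup>2"
    by (simp add: cinner_simps cinner_self field_simps del: of_real_power of_real_divide of_real_diff)
  also have "\<dots> = \<rho> / 2 * ((norm h)\<^sup>2 - deform_par \<rho> * Re (cinner v h)
      + (deform_par \<rho> - 1) * (norm v)\<^sup>2)"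
    using \<rho> by (simp add: deform_par_def field_simps)
  also have "0 \<le> \<dots>" using ker[OF z, of h] \<rho> by (simp add: v_def)
  finally show "0 \<le> Re (cinner (h + complex_of_real ((\<rho> - 2) / 2) *\<^sub>C (h - z *\<^sub>C S h)) (h - z *\<^sub>C S h))"
    by (simp add: v_def)
qed

lemma poly_op_pcompose_scale:
  fixes T S :: "'a::complex_inner \<Rightarrow> 'a"
  assumes T: "bounded_clinear T" and S: "bounded_clinear S" and TS: "\<And>x. T x = c *\<^sub>C S x"
  shows "poly_op (pcompose p [:0, c:]) S x = poly_op p T x"
proof (induction p)
  case (pCons a p)
  have X: "poly_op [:0, c:] S y = T y" for y
    by (simp add: poly_op_pCons[OF S] poly_op_0 scaleC.zero_left clinear_0[OF S] TS
        clinear_scaleC[OF S])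
  have a: "poly_op [:a:] S y = a *\<^sub>C y" for y
    by (simp add: poly_op_def)
  show ?case
    unfolding pcompose_pCons poly_op_add poly_op_mult[OF S] X a pCons poly_op_pCons[OF T] ..
qed (simp add: poly_op_0)

lemma norm_poly_op_le_radius:
  fixes T :: "'a::complex_inner \<Rightarrow> 'a"
  assumes T: "bounded_clinear T" and \<rho>: "1 \<le> \<rho>"
    and R: "deformed_numerical_radius \<rho> T < R" "0 < R"
    and M: "0 < M" "\<And>z. cmod z \<le> R \<Longrightarrow> cmod (poly p z) \<le> M"
  shows "norm (poly_op p T x) \<le> \<rho> * M * norm x"
proof -
  define r where "r = deform_par \<rho>"
  note r = deform_par_bounds[OF \<rho>, folded r_def]
  define S where "S x = complex_of_real (1 / R) *\<^sub>C T x" for x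
  have S: "bounded_clinear S" unfolding bounded_clinear_def
  proof (intro conjI allI)
    show "bounded_linear S" unfolding S_def[abs_def]
      by (rule bounded_linear_compose[OF scaleC.bounded_linear_right clinear_bounded_linear[OF T]])
    show "S (c *\<^sub>C x) = c *\<^sub>C S x" for c x
      by (simp add: S_def clinear_scaleC[OF T] scaleC_scaleC mult.commute)
  qed
  have TS: "T x = complex_of_real R *\<^sub>C S x" for x
    using R(2) by (simp add: S_def scaleC_scaleC scaleC_one)
  \<comment> \<open>The midpoint of the radius over R and 1 keeps \<kappa> R above the radius; 1/2
    makes \<kappa> positive; r / 2 exceeds r - 1 because r < 2. All three stay below 1.\<close>
  define \<kappa> where "\<kappa> = max ((deformed_numerical_radius \<rho> T / R + 1) / 2) (max (1 / 2) (r / 2))"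
  have \<kappa>: "0 < \<kappa>" "\<kappa> < 1" "r - 1 < \<kappa>"
    using r R by (auto simp: \<kappa>_def less_max_iff_disj)
  have "deformed_numerical_radius \<rho> T < \<kappa> * R"
  proof -
    have "deformed_numerical_radius \<rho> T / R < (deformed_numerical_radius \<rho> T / R + 1) / 2"
      using R by (simp add: field_simps)
    also have "\<dots> \<le> \<kappa>" by (simp add: \<kappa>_def)
    finally show ?thesis using R by (simp add: field_simps)
  qed
  note K = deformed_radius_kernel_nonneg[OF T \<rho> this, folded r_def]
  have ker: "0 \<le> (norm h)\<^sup>2 - r * Re (cinner (z *\<^sub>C S h) h) + (r - 1) * (norm (z *\<^sub>C S h))\<^sup>2"
    if z: "cmod z * \<kappa> \<le> 1" for z h
    using K[of "z / complex_of_real R" h] z R \<kappa>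
    by (simp add: S_def scaleC_scaleC norm_divide mult.commute)
  obtain C where C: "0 \<le> C" "resolvent_bound S C 1"
    using resolvent_bound_if_margin[OF \<kappa> ker] by blast
  have van: "powers_vanish S 1"
    by (rule powers_vanish_if_resolvent_bound[OF S C]) simp
  have pos: "resolvent_positive \<rho> S"
    by (rule resolvent_positive_if_kernel[OF \<rho>]) (use ker \<kappa> in \<open>simp add: r_def del: norm_scaleC\<close>)
  define f where "f = smult (complex_of_real (1 / M)) (pcompose p [:0, complex_of_real R:])"
  have f: "cmod (poly f z) \<le> 1" if "cmod z \<le> 1" for z
  proof -
    have "cmod (z * complex_of_real R) \<le> R"
      using that R by (simp add: norm_mult mult_left_le_one_le)
    from M(2)[OF this] show ?thesis
      using M(1) by (simp add: f_def poly_pcompose norm_mult norm_divide)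
  qed
  have "norm (poly_op g S y + (complex_of_real (\<rho> - 1) * poly g 0) *\<^sub>C y) \<le> \<rho> * norm y"
    if "\<And>z. cmod z \<le> 1 \<Longrightarrow> cmod (poly g z) \<le> 1" for g y
    by (rule norm_poly_op_shifted_le[OF S \<rho> pos van]) (simp add: that)
  hence "norm (poly_op f S x) \<le> \<rho> * norm x"
    by (rule norm_poly_op_le_if_shifted[OF S \<rho> _ f])
  moreover have "poly_op f S x = complex_of_real (1 / M) *\<^sub>C poly_op p T x"
    unfolding f_def poly_op_smult poly_op_pcompose_scale[OF T S TS] ..
  ultimately show ?thesis using M(1) by (simp add: norm_divide field_simps)
qed

text \<open>A point z outside the disc is compared with its radial projection w, at distance |z| -
  \<nu>, by uniform continuity on a larger disc.\<close>

lemma poly_bound_slightly_larger_disc: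
  assumes \<nu>: "0 \<le> \<nu>" and M: "\<And>z. cmod z \<le> \<nu> \<Longrightarrow> cmod (poly p z) \<le> M" and \<epsilon>: "0 < \<epsilon>"
  shows "\<exists>R>\<nu>. \<forall>z. cmod z \<le> R \<longrightarrow> cmod (poly p z) \<le> M + \<epsilon>"
proof -
  have "uniformly_continuous_on (cball 0 (\<nu> + 1)) (poly p)"
    by (intro compact_uniformly_continuous continuous_intros) auto
  then obtain d where d: "d > 0"
    "\<And>w z. cmod w \<le> \<nu> + 1 \<Longrightarrow> cmod z \<le> \<nu> + 1 \<Longrightarrow> dist z w < d \<Longrightarrow> dist (poly p z) (poly p w) < \<epsilon>"
    unfolding uniformly_continuous_on_def using \<epsilon> by (force simp: dist_norm)
  define R where "R = \<nu> + min 1 (d / 2)"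
  have "cmod (poly p z) \<le> M + \<epsilon>" if z: "cmod z \<le> R" for z
  proof (cases "cmod z \<le> \<nu>")
    case True
    thus ?thesis using M[of z] \<epsilon> by simp
  next
    case False
    define w where "w = complex_of_real (\<nu> / cmod z) * z"
    have z0: "0 < cmod z" using False \<nu> by linarith
    have w: "cmod w = \<nu>" using z0 \<nu> by (simp add: w_def norm_mult norm_divide)
    have "z - w = complex_of_real (1 - \<nu> / cmod z) * z" by (simp add: w_def algebra_simps)
    hence "cmod (z - w) = \<bar>1 - \<nu> / cmod z\<bar> * cmod z" by (simp only: norm_mult norm_of_real)
    also have "\<dots> = cmod z - \<nu>" using False z0 by (simp add: abs_if field_simps)
    finally have "dist z w < d" using z d(1) by (simp add: dist_norm R_def)
    hence "dist (poly p z) (poly p w) < \<epsilon>" using z w by (intro d(2)) (auto simp: R_def)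
    hence "cmod (poly p z) < cmod (poly p w) + \<epsilon>"
      using norm_triangle_ineq2[of "poly p z" "poly p w"] by (simp add: dist_norm)
    thus ?thesis using M[of w] w by simp
  qed
  thus ?thesis using d(1) by (intro exI[of _ R]) (auto simp: R_def)
qed

theorem theorem13:
  fixes T :: "'a::complex_hilbert_space \<Rightarrow> 'a"
    and p :: "complex poly"
    and \<rho> :: real
  assumes "(UNIV :: 'a set) \<noteq> {0}"
    and "bounded_clinear T"
    and "1 \<le> \<rho>"
  shows "onorm (poly_op p T)
    \<le> \<rho> * (SUP z \<in> (\<lambda>w. complex_of_real (deformed_numerical_radius \<rho> T) * w) ` cball 0 1.
             cmod (poly p z))"
proof -
  define \<nu> where "\<nu> = deformed_numerical_radius \<rho> T"
  define A where "A = (\<lambda>w. complex_of_real \<nu> * w) ` cball 0 1"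
  define M where "M = (SUP z\<in>A. cmod (poly p z))"
  note \<nu> = deformed_radius_nonneg[OF assms(2,3,1), folded \<nu>_def]
  have "compact A" unfolding A_def by (intro compact_continuous_image continuous_intros) auto
  hence "compact ((\<lambda>z. cmod (poly p z)) ` A)" by (intro compact_continuous_image continuous_intros)
  hence bdd: "bdd_above ((\<lambda>z. cmod (poly p z)) ` A)" by (intro bounded_imp_bdd_above compact_imp_bounded)
  have M: "cmod (poly p z) \<le> M" if "cmod z \<le> \<nu>" for z
  proof -
    have "z \<in> A"
    proof (cases "\<nu> = 0")
      case True
      thus ?thesis using that by (auto simp: A_def intro!: image_eqI[of _ _ 0])
    next
      case False
      hence "z = complex_of_real \<nu> * (z / complex_of_real \<nu>)" "cmod (z / complex_of_real \<nu>) \<le> 1"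
        using that \<nu> by (simp_all add: norm_divide)
      thus ?thesis unfolding A_def by (intro image_eqI) auto
    qed
    thus ?thesis unfolding M_def by (rule cSUP_upper[OF _ bdd])
  qed
  have M0: "0 \<le> M" using order_trans[OF norm_ge_zero M[of 0]] \<nu> by simp
  have "norm (poly_op p T x) \<le> \<rho> * M * norm x" for x
  proof (rule field_le_epsilon)
    fix e :: real assume e: "0 < e"
    define \<epsilon> where "\<epsilon> = e / (\<rho> * norm x + 1)"
    have den: "0 < \<rho> * norm x + 1" using assms(3) by (intro add_nonneg_pos) auto
    hence \<epsilon>: "0 < \<epsilon>" using e by (simp add: \<epsilon>_def)
    obtain R where R: "\<nu> < R" "\<And>z. cmod z \<le> R \<Longrightarrow> cmod (poly p z) \<le> M + \<epsilon>"
      using poly_bound_slightly_larger_disc[OF \<nu> M \<epsilon>] by blast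
    \<comment> \<open>The \<epsilon> makes the bound strictly positive even for M = 0, and R > \<nu>
      supplies the strict margin.\<close>
    have "norm (poly_op p T x) \<le> \<rho> * (M + \<epsilon>) * norm x"
      using R \<nu> M0 \<epsilon> by (intro norm_poly_op_le_radius[OF assms(2,3), of R]) (auto simp: \<nu>_def)
    also have "\<dots> = \<rho> * M * norm x + \<epsilon> * (\<rho> * norm x)" by (simp add: algebra_simps)
    also have "\<epsilon> * (\<rho> * norm x) \<le> \<epsilon> * (\<rho> * norm x + 1)" using \<epsilon> by (intro mult_left_mono) auto
    also have "\<epsilon> * (\<rho> * norm x + 1) = e" using den by (simp add: \<epsilon>_def)
    finally show "norm (poly_op p T x) \<le> \<rho> * M * norm x + e" by simp
  qed
  hence "onorm (poly_op p T) \<le> \<rho> * M"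
    using M0 assms(3) by (intro onorm_bound) auto
  thus ?thesis by (simp add: M_def A_def \<nu>_def)
qed

end
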